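(* There is an almost disjoint family $\mathcal{A}=\{A_\xi:\xi<\mathfrak{a}\}$ of subsets of $\mathbb{N}$ such that there is no bounded linear operator $S:\ell_\infty^c(\mathfrak{a})\to C(\mathbb{N}^* )$ satisfying $S(1_{\{\xi\}})=1_{[A_\xi]}$ for every $\xi<\mathfrak{a}$. In particular, $\ell_\infty/c_0$ is not universally $c_0(\mathfrak{a})$-injective.
   Context: All Banach spaces are over $\mathbb{R}$; operators are by convention bounded and linear. An almost disjoint family is an infinite family of infinite subsets of $\mathbb{N}$ any two distinct members of which have finite intersection; an indexed family $\{A_\xi:\xi<\kappa\}$ is enumerated without repetitions. $\mathfrak{a}$ is the smallest infinite cardinality of a maximal almost disjoint family. $\ell_\infty^c(\kappa)$ is the subspace of $\ell_\infty(\kappa)$ (supremum norm) consisting of the elements with countable support. $1_A$ is the characteristic function of $A$. $\mathbb{N}^*=\beta\mathbb{N}\setminus\mathbb{N}$, identified with the Stone space of $\wp(\mathbb{N})/Fin$; for $A\subseteq\mathbb{N}$, $[A]$ is the class of $A$ modulo finite sets, identified with the corresponding clopen subset of $\mathbb{N}^*$. $C(\mathbb{N}^* )$ (supremum norm) is canonically isometric to $\ell_\infty/c_0$ via an isometry sending the class $[1_A]$ to $1_{[A]}$. A Banach space $X$ is universally $Y$-injective if for every Banach space $Z$ isomorphic (linearly homeomorphic) to $Y$ and every Banach space $Z'\supseteq Z$, every operator $T:Z\to X$ extends to an operator $\tilde T:Z'\to X$. *)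

theory Defs
  imports "HOL-Analysis.Analysis" "HOL-Algebra.AbelCoset" "HOL-Algebra.Module"
begin

unbundle cardinal_syntax

section \<open>Almost disjoint families and the cardinal \<open>\<aa>\<close>\<close>

definition almost_disjoint_family :: "nat set set \<Rightarrow> bool" where
  "almost_disjoint_family F \<longleftrightarrow>
     infinite F \<and> (\<forall>A\<in>F. infinite A) \<and> (\<forall>A\<in>F. \<forall>B\<in>F. A \<noteq> B \<longrightarrow> finite (A \<inter> B))"

definition mad_family :: "nat set set \<Rightarrow> bool" where
  "mad_family F \<longleftrightarrow>
     almost_disjoint_family F \<and> (\<forall>G. almost_disjoint_family G \<and> F \<subseteq> G \<longrightarrow> G = F)"

text \<open>
  Cardinals are those of \<open>HOL.BNF_Cardinal_Order_Relation\<close>: well-order relations \<open>r\<close> that are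
  minimal on their field. The ordinals \<open>\<xi> < \<aa>\<close> are therefore the elements of \<open>Field \<aa>\<close>. Since
  \<open>\<aa>\<close> is at most the cardinality of the continuum, it can be placed on the type \<^typ>\<open>nat set\<close>.
  Lemma \<open>least_mad\<close> below shows that the choice is well defined.
\<close>

definition least_mad_cardinal :: "nat set rel \<Rightarrow> bool" where
  "least_mad_cardinal r \<longleftrightarrow>
     (\<exists>F. mad_family F \<and> r = |F| ) \<and> (\<forall>G. mad_family G \<longrightarrow> r \<le>o |G| )"

definition ad_number :: "nat set rel" (\<open>\<aa>\<close>) where
  "\<aa> = (SOME r. least_mad_cardinal r)"

lemma mad_family_exists: "\<exists>F. mad_family F"
proof -
  define P where "P = range (\<lambda>k::nat. prod_encode ` ({k} \<times> UNIV))"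
  have disj: "prod_encode ` ({k} \<times> UNIV) \<inter> prod_encode ` ({l} \<times> UNIV) = {}" if "k \<noteq> l" for k l
    using that inj_prod_encode[of UNIV] by (auto dest: injD)
  have inf: "infinite (prod_encode ` ({k} \<times> UNIV))" for k
    by (subst finite_image_iff) (auto simp: inj_prod_encode finite_cartesian_product_iff)
  have "inj (\<lambda>k::nat. prod_encode ` ({k} \<times> UNIV))"
  proof (rule injI, rule ccontr)
    fix k l :: nat
    assume "prod_encode ` ({k} \<times> UNIV) = prod_encode ` ({l} \<times> UNIV)" "k \<noteq> l"
    then show False
      using disj[of k l] inf[of l] by simp
  qed
  then have "infinite P"
    unfolding P_def using finite_imageD by blast
  moreover have "finite (A \<inter> B)" if AB: "A \<in> P" "B \<in> P" "A \<noteq> B" for A B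
  proof -
    obtain k l where "A = prod_encode ` ({k} \<times> UNIV)" "B = prod_encode ` ({l} \<times> UNIV)"
      using AB(1,2) unfolding P_def by blast
    then show ?thesis
      using AB(3) disj[of k l] by (metis finite.emptyI)
  qed
  ultimately have adP: "almost_disjoint_family P"
    using inf unfolding almost_disjoint_family_def P_def by blast
  let ?S = "{F. almost_disjoint_family F \<and> P \<subseteq> F}"
  have "\<exists>M\<in>?S. \<forall>X\<in>?S. M \<subseteq> X \<longrightarrow> X = M"
  proof (rule subset_Zorn_nonempty)
    show "?S \<noteq> {}"
      using adP by auto
    fix C assume C: "C \<noteq> {}" "subset.chain ?S C"
    then have ad: "F \<in> C \<Longrightarrow> almost_disjoint_family F \<and> P \<subseteq> F" for F
      by (auto simp: subset.chain_def)
    have lin: "F \<in> C \<Longrightarrow> G \<in> C \<Longrightarrow> F \<subseteq> G \<or> G \<subseteq> F" for F G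
      using C(2) unfolding subset_chain_def by simp
    have "P \<subseteq> \<Union>C"
      using C(1) ad by blast
    moreover have "finite (A \<inter> B)" if AB: "A \<in> \<Union>C" "B \<in> \<Union>C" "A \<noteq> B" for A B
    proof -
      obtain F G where FG: "F \<in> C" "G \<in> C" "A \<in> F" "B \<in> G"
        using AB(1,2) by (elim UnionE)
      obtain H where H: "H \<in> C" "A \<in> H" "B \<in> H"
        using lin[OF FG(1,2)] FG by (elim disjE) (auto dest: subsetD)
      show ?thesis
        using ad[OF H(1)] H(2,3) AB(3) unfolding almost_disjoint_family_def by simp
    qed
    moreover have "infinite A" if "A \<in> \<Union>C" for A
      using that ad unfolding almost_disjoint_family_def by blast
    moreover have "infinite (\<Union>C)"
      using \<open>infinite P\<close> \<open>P \<subseteq> \<Union>C\<close> finite_subset by blast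
    ultimately show "\<Union>C \<in> ?S"
      by (simp add: almost_disjoint_family_def)
  qed
  then obtain M where M: "almost_disjoint_family M" "P \<subseteq> M" "\<forall>G\<in>?S. M \<subseteq> G \<longrightarrow> G = M"
    by auto
  have "mad_family M"
    unfolding mad_family_def using M(1) M(3) order_trans[OF M(2)] by simp
  then show ?thesis ..
qed

lemma least_mad: "least_mad_cardinal \<aa>"
proof -
  let ?R = "{|F| | F. mad_family F}"
  have "?R \<noteq> {}" "\<forall>r\<in>?R. Card_order r"
    using mad_family_exists by (auto simp: card_of_Card_order)
  then obtain r where "r \<in> ?R" "\<forall>r'\<in>?R. r \<le>o r'"
    using exists_minim_Card_order[of ?R] by blast
  then have "least_mad_cardinal r"
    unfolding least_mad_cardinal_def by blast
  then show ?thesis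
    unfolding ad_number_def by (rule someI)
qed


section \<open>Real Banach spaces on a carrier\<close>

text \<open>
  Quantifying over Banach spaces inside a definition requires Banach spaces as objects, not as
  types. The vector space structure is that of a \<open>HOL-Algebra\<close> module over the field \<open>real_ring\<close>.
  The fields \<open>mult\<close> and \<open>one\<close> that module records inherit from ring records play no role.
\<close>

definition real_ring :: "real ring" where
  "real_ring = \<lparr>carrier = UNIV, mult = (*), one = 1, zero = 0, add = (+)\<rparr>"

record 'a normed_space = "(real, 'a) module" +
  nrm :: "'a \<Rightarrow> real"

locale real_normed_space = module real_ring X
  for X :: "'a normed_space" (structure) +
  assumes nrm_nonneg: "x \<in> carrier X \<Longrightarrow> 0 \<le> nrm X x"
    and nrm_eq_zero: "x \<in> carrier X \<Longrightarrow> nrm X x = 0 \<longleftrightarrow> x = \<zero>"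
    and nrm_triangle: "x \<in> carrier X \<Longrightarrow> y \<in> carrier X \<Longrightarrow> nrm X (x \<oplus> y) \<le> nrm X x + nrm X y"
    and nrm_smult: "x \<in> carrier X \<Longrightarrow> nrm X (c \<odot> x) = \<bar>c\<bar> * nrm X x"

locale banach_space = real_normed_space +
  assumes complete:
    "range \<sigma> \<subseteq> carrier X \<Longrightarrow> \<forall>e>0. \<exists>N. \<forall>m\<ge>N. \<forall>n\<ge>N. nrm X (\<sigma> m \<ominus> \<sigma> n) < e \<Longrightarrow>
     \<exists>x\<in>carrier X. (\<lambda>n. nrm X (\<sigma> n \<ominus> x)) \<longlonglongrightarrow> 0"

definition bounded_operator :: "'a normed_space \<Rightarrow> 'b normed_space \<Rightarrow> ('a \<Rightarrow> 'b) \<Rightarrow> bool" where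
  "bounded_operator X Y T \<longleftrightarrow>
     (\<forall>x\<in>carrier X. T x \<in> carrier Y) \<and>
     (\<forall>x\<in>carrier X. \<forall>y\<in>carrier X. T (x \<oplus>\<^bsub>X\<^esub> y) = T x \<oplus>\<^bsub>Y\<^esub> T y) \<and>
     (\<forall>c. \<forall>x\<in>carrier X. T (c \<odot>\<^bsub>X\<^esub> x) = c \<odot>\<^bsub>Y\<^esub> T x) \<and>
     (\<exists>C. \<forall>x\<in>carrier X. nrm Y (T x) \<le> C * nrm X x)"

definition isomorphic_spaces :: "'a normed_space \<Rightarrow> 'b normed_space \<Rightarrow> bool" where
  "isomorphic_spaces X Y \<longleftrightarrow>
     (\<exists>T. bounded_operator X Y T \<and> bij_betw T (carrier X) (carrier Y) \<and>
          bounded_operator Y X (inv_into (carrier X) T))"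

definition subspace_of :: "'a normed_space \<Rightarrow> 'a normed_space \<Rightarrow> bool" where
  "subspace_of Z Z' \<longleftrightarrow>
     carrier Z \<subseteq> carrier Z' \<and>
     (\<forall>x\<in>carrier Z. \<forall>y\<in>carrier Z. x \<oplus>\<^bsub>Z\<^esub> y = x \<oplus>\<^bsub>Z'\<^esub> y) \<and>
     (\<forall>c. \<forall>x\<in>carrier Z. c \<odot>\<^bsub>Z\<^esub> x = c \<odot>\<^bsub>Z'\<^esub> x) \<and>
     (\<forall>x\<in>carrier Z. nrm Z x = nrm Z' x)"

text \<open>
  Universal \<open>Y\<close>-injectivity of \<open>X\<close>. HOL cannot quantify over all types, so \<open>Z\<close> and \<open>Z'\<close> range over
  all Banach spaces with underlying set in the type \<^typ>\<open>('y \<Rightarrow> real) \<Rightarrow> real\<close>, where \<^typ>\<open>'y\<close> is the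
  type of \<open>Y\<close>. This loses nothing. Let \<open>B\<close> be the dual unit ball of \<open>Y\<close>, so that \<open>\<ell>\<^sub>\<infinity>(B)\<close> can be
  realised on that type, and let \<open>J : Y \<rightarrow> \<ell>\<^sub>\<infinity>(B)\<close> be the canonical isometric embedding. Given
  arbitrary \<open>Z' \<supseteq> Z\<close>, an isomorphism \<open>\<phi> : Z \<rightarrow> Y\<close> and \<open>T : Z \<rightarrow> X\<close>, Hahn-Banach extends \<open>J \<circ> \<phi>\<close> to
  \<open>R : Z' \<rightarrow> \<ell>\<^sub>\<infinity>(B)\<close>. If \<open>T \<circ> (J \<circ> \<phi>)\<^sup>-\<^sup>1 : J(Y) \<rightarrow> X\<close> extends to \<open>T' : \<ell>\<^sub>\<infinity>(B) \<rightarrow> X\<close>, then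
  \<open>T' \<circ> R\<close> extends \<open>T\<close>.
\<close>

definition universally_injective :: "'y normed_space \<Rightarrow> 'x normed_space \<Rightarrow> bool" where
  "universally_injective Y X \<longleftrightarrow>
     (\<forall>(Z :: (('y \<Rightarrow> real) \<Rightarrow> real) normed_space) Z' T.
        banach_space Z \<and> isomorphic_spaces Z Y \<and> banach_space Z' \<and> subspace_of Z Z' \<and>
        bounded_operator Z X T \<longrightarrow>
        (\<exists>T'. bounded_operator Z' X T' \<and> (\<forall>z\<in>carrier Z. T' z = T z)))"


section \<open>The concrete spaces\<close>

text \<open>
  A function on a set \<open>K\<close> is represented by its extension by zero to the whole type, so that the
  supremum of \<open>\<bar>f\<bar>\<close> over \<open>K\<close> equals the one over the type (for \<open>K = {}\<close> too).
\<close>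

definition sup_norm_space :: "('k \<Rightarrow> real) set \<Rightarrow> ('k \<Rightarrow> real) normed_space" where
  "sup_norm_space V =
     \<lparr>carrier = V, mult = undefined, one = undefined, zero = (\<lambda>_. 0),
      add = (\<lambda>f g k. f k + g k), smult = (\<lambda>c f k. c * f k),
      nrm = (\<lambda>f. SUP k. \<bar>f k\<bar>)\<rparr>"

definition linf :: "'k set \<Rightarrow> ('k \<Rightarrow> real) normed_space" where
  "linf K = sup_norm_space {f. (\<forall>k. k \<notin> K \<longrightarrow> f k = 0) \<and> bounded (range f)}"

definition linf_c :: "'k set \<Rightarrow> ('k \<Rightarrow> real) normed_space" where
  "linf_c K = sup_norm_space {f \<in> carrier (linf K). countable {k. f k \<noteq> 0}}"

definition c0 :: "'k set \<Rightarrow> ('k \<Rightarrow> real) normed_space" where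
  "c0 K = sup_norm_space {f. (\<forall>k. k \<notin> K \<longrightarrow> f k = 0) \<and> (\<forall>e>0. finite {k. e \<le> \<bar>f k\<bar>})}"

definition continuous_space :: "'p topology \<Rightarrow> ('p \<Rightarrow> real) normed_space" where
  "continuous_space T =
     sup_norm_space {f. (\<forall>p. p \<notin> topspace T \<longrightarrow> f p = 0) \<and> continuous_map T euclideanreal f}"

definition quotient_space :: "'a normed_space \<Rightarrow> 'a set \<Rightarrow> 'a set normed_space" where
  "quotient_space X M =
     \<lparr>carrier = a_rcosets\<^bsub>X\<^esub> M, mult = undefined, one = undefined, zero = M,
      add = set_add X,
      smult = (\<lambda>c C. M <+>\<^bsub>X\<^esub> ((\<lambda>x. c \<odot>\<^bsub>X\<^esub> x) ` C)), \<comment> \<open>the summand \<open>M\<close> matters for \<open>c = 0\<close>\<close>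
      nrm = (\<lambda>C. INF x\<in>C. nrm X x)\<rparr>"

definition linf_mod_c0 :: "(nat \<Rightarrow> real) set normed_space" where
  "linf_mod_c0 = quotient_space (linf UNIV) (carrier (c0 UNIV))"

text \<open>
  The points of \<open>\<beta>\<nat> \<setminus> \<nat>\<close> are the non-principal ultrafilters on \<open>\<nat>\<close>, i.e. the ultrafilters of
  \<open>\<P>(\<nat>)/Fin\<close>. The set \<open>A\<close> belongs to the ultrafilter \<open>U\<close> if \<open>n \<in> A\<close> holds eventually along \<open>U\<close>.
\<close>

definition ultrafilter :: "'a filter \<Rightarrow> bool" where
  "ultrafilter U \<longleftrightarrow> U \<noteq> bot \<and> (\<forall>P. eventually P U \<or> eventually (\<lambda>x. \<not> P x) U)"

definition nstar_points :: "nat filter set" where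
  "nstar_points = {U. ultrafilter U \<and> (\<forall>n. U \<noteq> principal {n})}"

definition nstar_clopen :: "nat set \<Rightarrow> nat filter set" where
  "nstar_clopen A = {U \<in> nstar_points. eventually (\<lambda>n. n \<in> A) U}"

definition nstar :: "nat filter topology" where
  "nstar = topology_generated_by (range nstar_clopen)"

end

theory Submission
  imports Defs
begin

text \<open>
  A maximal almost disjoint family \<open>F\<close> of cardinality \<open>\<aa>\<close> serves for both claims. Suppose that
  \<open>S\<close> sends \<open>1\<^bsub>{A}\<^esub>\<close> to \<open>1\<^bsub>[A]\<^esub>\<close> for \<open>A \<in> F\<close>. Start with a set \<open>B\<close> that meets infinitely many members
  of \<open>F\<close> in an infinite set and with a countable \<open>C \<subseteq> F\<close> such that \<open>S 1\<^sub>C \<ge> n/4\<close> on \<open>[B]\<close>. By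
  maximality, \<open>B\<close> meets uncountably many members of \<open>F\<close> in an infinite set, so infinitely many
  of these lie outside \<open>C\<close>. Choose ultrafilters \<open>p A \<in> [A \<inter> B]\<close> for these \<open>A\<close>. Rosenthal's lemma
  gives an infinite countable set \<open>D\<close> of such members with \<open>S 1\<^sub>D (p A) \<ge> 1/2\<close> for \<open>A \<in> D\<close>, and
  \<open>B\<close> can be shrunk so that \<open>S 1\<^sub>D > 1/4\<close> on \<open>[B]\<close>. Replacing \<open>C\<close> by \<open>C \<union> D\<close> increases \<open>n\<close> by one,
  while the norm of \<open>1\<^sub>C\<close> never exceeds \<open>1\<close>; so \<open>S\<close> is unbounded.

  For the second claim, an extension to \<open>\<ell>\<^sub>\<infinity>\<^sup>c\<close> of the operator \<open>c\<^sub>0 \<rightarrow> \<ell>\<^sub>\<infinity>/c\<^sub>0\<close> with \<open>1\<^bsub>{A}\<^esub> \<mapsto> [1\<^sub>A]\<close>,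
  followed by the limits along nonprincipal ultrafilters, would be such an operator \<open>S\<close>.
\<close>

section \<open>The Stone space of \<open>\<P>(\<nat>)/Fin\<close>\<close>

text \<open>Zorn's lemma towards finer filters: the infimum of a chain of proper filters is proper,
  since each of its eventual properties is already eventual for some member. A minimal proper filter
  is an ultrafilter.\<close>

lemma ultrafilter_below:
  fixes F :: "'a filter"
  assumes "F \<noteq> bot"
  obtains U where "ultrafilter U" "U \<le> F"
proof -
  let ?R = "{(G, H). G \<noteq> bot \<and> H \<noteq> bot \<and> G \<le> F \<and> H \<le> F \<and> H \<le> G}"
  have field: "Field ?R = {G. G \<noteq> bot \<and> G \<le> F}"
    by (auto simp: Field_def)
  have "\<exists>U\<in>Field ?R. \<forall>G\<in>Field ?R. (U, G) \<in> ?R \<longrightarrow> G = U"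
  proof (rule Zorns_po_lemma)
    show "Partial_order ?R"
      unfolding partial_order_on_def preorder_on_def field
      by (auto simp: refl_on_def trans_def antisym_def)
  next
    fix C assume C: "C \<in> Chains ?R"
    show "\<exists>u\<in>Field ?R. \<forall>G\<in>C. (G, u) \<in> ?R"
    proof (cases "C = {}")
      case True
      then show ?thesis using assms field by blast
    next
      case False
      have members: "G \<noteq> bot" "G \<le> F" if "G \<in> C" for G
        using C that by (auto simp: Chains_def)
      have lin: "G \<le> H \<or> H \<le> G" if "G \<in> C" "H \<in> C" for G H
        using C that by (auto simp: Chains_def)
      have "eventually P (Inf C) \<longleftrightarrow> (\<exists>G\<in>C. eventually P G)" for P
      proof (rule eventually_Inf_base[OF False])
        fix G H assume "G \<in> C" "H \<in> C"
        with lin[OF this] show "\<exists>K\<in>C. K \<le> inf G H"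
          by (auto intro: bexI[of _ G] bexI[of _ H])
      qed
      then have "Inf C \<noteq> bot"
        using members(1) by (auto simp: trivial_limit_def)
      moreover have "Inf C \<le> F"
        using False members(2) by (meson Inf_lower2 ex_in_conv)
      ultimately show ?thesis
        unfolding field using members by (intro bexI[of _ "Inf C"]) (auto intro: Inf_lower)
    qed
  qed
  then obtain U where U: "U \<noteq> bot" "U \<le> F"
    and min: "\<And>G. G \<noteq> bot \<Longrightarrow> G \<le> U \<Longrightarrow> G = U"
    unfolding field by (auto dest: order_trans)
  have "eventually P U \<or> eventually (\<lambda>x. \<not> P x) U" for P
  proof (rule disjCI)
    assume "\<not> eventually (\<lambda>x. \<not> P x) U"
    \<comment> \<open>Adding a set whose complement is not in \<open>U\<close> keeps the filter
      proper, so minimality returns \<open>U\<close> itself.\<close>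
    then have "inf U (principal {x. P x}) \<noteq> bot"
      by (simp add: trivial_limit_def eventually_inf_principal)
    then have "inf U (principal {x. P x}) = U"
      by (intro min) auto
    then show "eventually P U"
      by (simp add: inf.absorb_iff1[symmetric] le_principal)
  qed
  with U that show ?thesis
    unfolding ultrafilter_def by blast
qed

text \<open>An ultrafilter containing \<open>{n}\<close> equals \<open>principal {n}\<close>. A
  nonprincipal one therefore contains the complement of each point, hence each cofinite set.\<close>

lemma nstar_point_le_cofinite:
  assumes "U \<in> nstar_points"
  shows "U \<le> cofinite"
proof -
  have U: "U \<noteq> bot" "\<And>P. eventually P U \<or> eventually (\<lambda>x. \<not> P x) U" "\<And>n. U \<noteq> principal {n}"
    using assms by (auto simp: nstar_points_def ultrafilter_def)
  have "eventually (\<lambda>x. x \<noteq> n) U" for n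
  proof (rule ccontr)
    assume "\<not> eventually (\<lambda>x. x \<noteq> n) U"
    then have ev: "eventually (\<lambda>x. x = n) U"
      using U(2)[of "\<lambda>x. x = n"] by auto
    have "U = principal {n}"
    proof (rule filter_eq_iff[THEN iffD2, rule_format])
      fix P
      show "eventually P U \<longleftrightarrow> eventually P (principal {n})"
      proof
        assume "eventually P U"
        with ev have "eventually (\<lambda>x. P n) U"
          by eventually_elim auto
        then show "eventually P (principal {n})"
          using U(1) by (simp add: eventually_principal)
      next
        assume "eventually P (principal {n})"
        then show "eventually P U"
          using ev by (auto simp: eventually_principal elim: eventually_mono)
      qed
    qed
    then show False using U(3) by blast
  qed
  then have "eventually P U" if "finite {x. \<not> P x}" for P
    using eventually_ball_finite[OF that, of "\<lambda>x n. x \<noteq> n" U] by (auto elim: eventually_mono)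
  then show ?thesis
    unfolding le_filter_def eventually_cofinite by blast
qed

lemma nstar_points_iff: "U \<in> nstar_points \<longleftrightarrow> ultrafilter U \<and> U \<le> cofinite"
proof -
  have "\<not> principal {n::nat} \<le> cofinite" for n
    by (auto simp: le_filter_def eventually_cofinite eventually_principal intro!: exI[of _ "\<lambda>x. x \<noteq> n"])
  then show ?thesis
    using nstar_point_le_cofinite[of U] by (auto simp: nstar_points_def)
qed

text \<open>Any ultrafilter below the cofinite filter restricted to \<open>A\<close> will do; this
  restriction is proper because \<open>A\<close> is infinite.\<close>

lemma nstar_clopen_nonempty:
  assumes "infinite A"
  obtains U where "U \<in> nstar_clopen A"
proof -
  have "inf cofinite (principal A) \<noteq> bot"
    using assms by (simp add: trivial_limit_def eventually_inf_principal eventually_cofinite)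
  then obtain U where "ultrafilter U" "U \<le> inf cofinite (principal A)"
    by (rule ultrafilter_below)
  then have "U \<in> nstar_clopen A"
    by (simp add: nstar_clopen_def nstar_points_iff le_principal)
  then show ?thesis by (rule that)
qed

lemma nstar_clopen_infinite:
  assumes "U \<in> nstar_clopen A"
  shows "infinite A"
proof
  assume "finite A"
  then have "eventually (\<lambda>n. n \<notin> A) cofinite"
    by (simp add: eventually_cofinite)
  then have "eventually (\<lambda>n. n \<notin> A) U"
    using assms by (auto simp: nstar_clopen_def nstar_points_iff le_filter_def)
  moreover have "eventually (\<lambda>n. n \<in> A) U" "U \<noteq> bot"
    using assms by (auto simp: nstar_clopen_def nstar_points_def ultrafilter_def)
  ultimately show False
    using eventually_conj by fastforce
qed

lemma nstar_clopen_Int: "nstar_clopen (A \<inter> B) = nstar_clopen A \<inter> nstar_clopen B"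
  by (auto simp: nstar_clopen_def eventually_conj_iff)

lemma nstar_clopen_mono: "A \<subseteq> B \<Longrightarrow> nstar_clopen A \<subseteq> nstar_clopen B"
  by (auto simp: nstar_clopen_def elim: eventually_mono)

lemma nstar_clopen_UNIV [simp]: "nstar_clopen UNIV = nstar_points"
  by (auto simp: nstar_clopen_def)

lemma nstar_clopen_Compl: "nstar_clopen (- A) = nstar_points - nstar_clopen A"
proof -
  have "\<not> (eventually (\<lambda>n. n \<in> A) U \<and> eventually (\<lambda>n. n \<notin> A) U)" if "ultrafilter U" for U
    using that by (auto simp: ultrafilter_def eventually_conj_iff[symmetric])
  then show ?thesis
    by (auto simp: nstar_clopen_def nstar_points_def ultrafilter_def)
qed

lemma nstar_clopen_Un: "nstar_clopen (A \<union> B) = nstar_clopen A \<union> nstar_clopen B"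
proof -
  have sub: "nstar_clopen X \<subseteq> nstar_points" for X
    by (auto simp: nstar_clopen_def)
  have "nstar_clopen (A \<union> B) = nstar_clopen (- (- A \<inter> - B))"
    by simp
  also have "\<dots> = nstar_points - (nstar_points - nstar_clopen A) \<inter> (nstar_points - nstar_clopen B)"
    by (simp only: nstar_clopen_Compl nstar_clopen_Int)
  also have "\<dots> = nstar_clopen A \<union> nstar_clopen B"
    using sub[of A] sub[of B] by blast
  finally show ?thesis .
qed

lemma topspace_nstar [simp]: "topspace nstar = nstar_points"
proof -
  have "nstar_clopen A \<subseteq> nstar_clopen UNIV" for A
    by (rule nstar_clopen_mono) simp
  then have "\<Union> (range nstar_clopen) = nstar_clopen UNIV"
    by blast
  then show ?thesis
    by (simp add: nstar_def topology_generated_by_topspace)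
qed

lemma openin_nstar_clopen: "openin nstar (nstar_clopen A)"
  unfolding nstar_def by (rule topology_generated_by_Basis) simp

text \<open>The generating sets are closed under finite intersections, so they form a base and not
  only a subbase.\<close>

lemma openin_nstar_base:
  assumes "openin nstar W" "U \<in> W"
  obtains A where "U \<in> nstar_clopen A" "nstar_clopen A \<subseteq> W"
proof -
  have "generate_topology_on (range nstar_clopen) W"
    using assms(1) by (simp add: nstar_def openin_topology_generated_by_iff)
  then have "\<forall>U\<in>W. \<exists>A. U \<in> nstar_clopen A \<and> nstar_clopen A \<subseteq> W"
  proof induction
    case (Int a b)
    then show ?case
      by (metis Int_iff Int_mono nstar_clopen_Int)
  next
    case (UN K)
    then show ?case by (meson Sup_upper UnionE subset_trans)
  qed auto
  with assms(2) that show ?thesis by blast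
qed

text \<open>The form of compactness of the Stone space that is convenient for ideals of subsets of \<open>\<nat>\<close>.\<close>

lemma nstar_local_to_global:
  assumes finite: "\<And>A. finite A \<Longrightarrow> P A"
    and mono: "\<And>A B. P B \<Longrightarrow> A \<subseteq> B \<Longrightarrow> P A"
    and union: "\<And>A B. P A \<Longrightarrow> P B \<Longrightarrow> P (A \<union> B)"
    and local: "\<And>U. U \<in> nstar_points \<Longrightarrow> \<exists>A. P A \<and> U \<in> nstar_clopen A"
  shows "P UNIV"
proof (rule ccontr)
  assume not: "\<not> P UNIV"
  \<comment> \<open>The filter dual to the ideal \<open>P\<close>. It is proper when
    \<open>P UNIV\<close> fails, and an ultrafilter below it lies in no
    \<open>nstar_clopen A\<close> with \<open>P A\<close>.\<close>
  define F where "F = Abs_filter (\<lambda>Q. P {n. \<not> Q n})"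
  have F: "eventually Q F \<longleftrightarrow> P {n. \<not> Q n}" for Q
    unfolding F_def
  proof (rule eventually_Abs_filter, rule is_filter.intro)
    show "P {n. \<not> True}"
      using finite[of "{}"] by simp
    show "P {n. \<not> (Q n \<and> R n)}" if "P {n. \<not> Q n}" "P {n. \<not> R n}" for Q R
      using union[OF that] by (rule mono) auto
    show "P {n. \<not> R n}" if "\<forall>n. Q n \<longrightarrow> R n" "P {n. \<not> Q n}" for Q R
      using that(2) by (rule mono) (use that(1) in auto)
  qed
  have "F \<noteq> bot"
    using not by (simp add: trivial_limit_def F)
  then obtain U where U: "ultrafilter U" "U \<le> F"
    by (rule ultrafilter_below)
  have "F \<le> cofinite"
    unfolding le_filter_def eventually_cofinite F using finite by blast
  with U have "U \<in> nstar_points"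
    by (simp add: nstar_points_iff)
  then obtain A where A: "P A" "U \<in> nstar_clopen A"
    using local by blast
  have "eventually (\<lambda>n. n \<notin> A) F"
    by (simp add: F A(1))
  then have "U \<in> nstar_clopen (- A)"
    using U(2) \<open>U \<in> nstar_points\<close> by (auto simp: nstar_clopen_def le_filter_def)
  with A(2) show False
    by (simp add: nstar_clopen_Compl)
qed

lemma nstar_clopen_finite: "finite A \<Longrightarrow> nstar_clopen A = {}"
  using nstar_clopen_infinite by blast

section \<open>Continuous functions on the Stone space and limits along its points\<close>

lemma nstar_continuous_nbhd:
  assumes "continuous_map nstar euclideanreal f" "U \<in> nstar_points" "open S" "f U \<in> S"
  obtains A where "U \<in> nstar_clopen A" "f ` nstar_clopen A \<subseteq> S"
proof -
  have "openin nstar {V \<in> nstar_points. f V \<in> S}"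
    using openin_continuous_map_preimage[OF assms(1), of S] assms(3) by simp
  then obtain A where "U \<in> nstar_clopen A" "nstar_clopen A \<subseteq> {V \<in> nstar_points. f V \<in> S}"
    by (rule openin_nstar_base) (use assms in auto)
  then show ?thesis by (intro that[of A]) auto
qed

text \<open>Compactness: the sets \<open>A\<close> for which \<open>f\<close> is bounded on
  \<open>nstar_clopen A\<close> form an ideal, and \<open>f\<close> is bounded near each
  point.\<close>

lemma nstar_continuous_bounded:
  assumes "continuous_map nstar euclideanreal f"
  shows "bounded (f ` nstar_points)"
proof -
  have "bounded (f ` nstar_clopen UNIV)"
  proof (rule nstar_local_to_global)
    fix U assume "U \<in> nstar_points"
    then obtain A where "U \<in> nstar_clopen A" "f ` nstar_clopen A \<subseteq> ball (f U) 1"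
      by (rule nstar_continuous_nbhd[OF assms, of _ "ball (f U) 1"]) auto
    then show "\<exists>A. bounded (f ` nstar_clopen A) \<and> U \<in> nstar_clopen A"
      using bounded_ball bounded_subset by blast
  next
    fix A B assume "bounded (f ` nstar_clopen B)" "A \<subseteq> B"
    then show "bounded (f ` nstar_clopen A)"
      by (meson bounded_subset image_mono nstar_clopen_mono)
  qed (auto simp: nstar_clopen_finite nstar_clopen_Un image_Un)
  then show ?thesis by simp
qed

text \<open>Call \<open>A\<close> good if it is covered by some \<open>B\<close> with
  \<open>f > a\<close> on \<open>nstar_clopen B\<close> and some \<open>C\<close> with
  \<open>f < b\<close> on \<open>nstar_clopen C\<close>. Good sets form an ideal and every point
  lies in \<open>nstar_clopen A\<close> for a good \<open>A\<close>, so by compactness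
  \<open>UNIV\<close> is good. Points with \<open>b \<le> f U\<close> are not over \<open>C\<close>,
  hence they are over \<open>B\<close>.\<close>

lemma nstar_clopen_between:
  fixes a b :: real
  assumes f: "continuous_map nstar euclideanreal f" and "a < b"
  obtains B where "\<And>U. U \<in> nstar_points \<Longrightarrow> b \<le> f U \<Longrightarrow> U \<in> nstar_clopen B"
    and "\<And>U. U \<in> nstar_clopen B \<Longrightarrow> a < f U"
proof -
  let ?P = "\<lambda>A. \<exists>B C. A \<subseteq> B \<union> C \<and> f ` nstar_clopen B \<subseteq> {a<..} \<and> f ` nstar_clopen C \<subseteq> {..<b}"
  have "?P UNIV"
  proof (rule nstar_local_to_global[of ?P])
    fix U assume U: "U \<in> nstar_points"
    show "\<exists>A. ?P A \<and> U \<in> nstar_clopen A"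
    proof (cases "a < f U")
      case True
      then obtain A where "U \<in> nstar_clopen A" "f ` nstar_clopen A \<subseteq> {a<..}"
        using nstar_continuous_nbhd[OF f U, of "{a<..}"] by auto
      then show ?thesis
        by (intro exI[of _ A] conjI exI[of _ A] exI[of _ "{}"]) (auto simp: nstar_clopen_finite)
    next
      case False
      then obtain A where "U \<in> nstar_clopen A" "f ` nstar_clopen A \<subseteq> {..<b}"
        using nstar_continuous_nbhd[OF f U, of "{..<b}"] \<open>a < b\<close> by auto
      then show ?thesis
        by (intro exI[of _ A] conjI exI[of _ "{}"] exI[of _ A]) (auto simp: nstar_clopen_finite)
    qed
  next
    fix A :: "nat set" assume "finite A"
    then show "?P A"
      by (intro exI[of _ A] exI[of _ "{}"]) (auto simp: nstar_clopen_finite)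
  next
    fix A A' :: "nat set" assume "?P A'" "A \<subseteq> A'"
    then show "?P A" by (meson order_trans)
  next
    fix A A' :: "nat set" assume P: "?P A" "?P A'"
    from P(1) obtain B C where BC: "A \<subseteq> B \<union> C"
      "f ` nstar_clopen B \<subseteq> {a<..}" "f ` nstar_clopen C \<subseteq> {..<b}"
      by (elim exE conjE)
    from P(2) obtain B' C' where "A' \<subseteq> B' \<union> C'"
      "f ` nstar_clopen B' \<subseteq> {a<..}" "f ` nstar_clopen C' \<subseteq> {..<b}"
      by (elim exE conjE)
    with BC show "?P (A \<union> A')"
      by (intro exI[of _ "B \<union> B'"] exI[of _ "C \<union> C'"] conjI)
        (auto simp: nstar_clopen_Un image_Un)
  qed
  then obtain B C where BC: "UNIV \<subseteq> B \<union> C" "f ` nstar_clopen B \<subseteq> {a<..}" "f ` nstar_clopen C \<subseteq> {..<b}"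
    by (elim exE conjE)
  show ?thesis
  proof
    fix U assume "U \<in> nstar_points" "b \<le> f U"
    then have "U \<in> nstar_clopen (B \<union> C)" "U \<notin> nstar_clopen C"
      using BC by (auto simp: top.extremum_unique)
    then show "U \<in> nstar_clopen B"
      by (simp add: nstar_clopen_Un)
  next
    fix U assume "U \<in> nstar_clopen B"
    then show "a < f U"
      using BC(2) by auto
  qed
qed

text \<open>The image of \<open>U\<close> under \<open>g\<close> lives on a compact set and so has a
  cluster point. An ultrafilter converges to each of its cluster points.\<close>

lemma nstar_tendsto_Lim:
  fixes g :: "nat \<Rightarrow> real"
  assumes "bounded (range g)" "U \<in> nstar_points"
  shows "(g \<longlongrightarrow> Lim U g) U"
proof -
  have U: "U \<noteq> bot" "\<And>P. eventually P U \<or> eventually (\<lambda>x. \<not> P x) U"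
    using assms(2) by (auto simp: nstar_points_def ultrafilter_def)
  have "compact (closure (range g))"
    using assms(1) by (simp add: compact_eq_bounded_closed bounded_closure)
  moreover have "filtermap g U \<noteq> bot"
    using U(1) by (simp add: filtermap_bot_iff)
  moreover have "eventually (\<lambda>x. x \<in> closure (range g)) (filtermap g U)"
    using closure_subset[of "range g"] by (auto simp: eventually_filtermap image_subset_iff)
  ultimately obtain l where l: "inf (nhds l) (filtermap g U) \<noteq> bot"
    unfolding compact_filter by blast
  have "(g \<longlongrightarrow> l) U"
  proof (rule topological_tendstoI, rule ccontr)
    fix S assume S: "open S" "l \<in> S" "\<not> eventually (\<lambda>n. g n \<in> S) U"
    then have "eventually (\<lambda>x. x \<notin> S) (filtermap g U)"
      using U(2) by (auto simp: eventually_filtermap)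
    moreover have "eventually (\<lambda>x. x \<in> S) (nhds l)"
      using S by (simp add: eventually_nhds_in_open)
    ultimately have "eventually (\<lambda>x. False) (inf (nhds l) (filtermap g U))"
      unfolding eventually_inf by (intro exI conjI) auto
    then show False
      using l by (simp add: trivial_limit_def)
  qed
  with tendsto_Lim[OF U(1) this] show ?thesis
    by simp
qed


section \<open>Almost disjointness and Rosenthal's lemma\<close>

text \<open>Diagonalisation: if only countably many members \<open>a 0, a 1, ...\<close> had
  infinite trace on \<open>B\<close>, then a set picking from each \<open>a n \<inter> B\<close> a
  point outside the earlier members would be almost disjoint from all of \<open>F\<close>, against
  maximality.\<close>

lemma mad_family_trace_uncountable:
  assumes F: "mad_family F" and inf: "infinite {A \<in> F. infinite (A \<inter> B)}"
  shows "uncountable {A \<in> F. infinite (A \<inter> B)}" (is "uncountable ?G")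
proof
  assume "countable ?G"
  define a where "a = from_nat_into ?G"
  have a: "bij_betw a UNIV ?G"
    unfolding a_def using \<open>countable ?G\<close> inf by (rule bij_betw_from_nat_into)
  have ad: "infinite F" "\<And>A. A \<in> F \<Longrightarrow> infinite A"
    "\<And>A A'. A \<in> F \<Longrightarrow> A' \<in> F \<Longrightarrow> A \<noteq> A' \<Longrightarrow> finite (A \<inter> A')"
    using F by (auto simp: mad_family_def almost_disjoint_family_def)
  have aF: "a n \<in> F" "infinite (a n \<inter> B)" for n
    using bij_betwE[OF a] by auto
  have "\<exists>e. e \<in> a n \<inter> B \<and> (\<forall>j<n. e \<notin> a j)" for n
  proof -
    have "finite (\<Union>j<n. a n \<inter> a j)"
      using bij_betw_imp_inj_on[OF a] by (intro finite_UN_I ad(3) aF(1)) (auto dest: injD)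
    then have "infinite (a n \<inter> B - (\<Union>j<n. a n \<inter> a j))"
      using aF(2) by (rule Diff_infinite_finite)
    then have "a n \<inter> B - (\<Union>j<n. a n \<inter> a j) \<noteq> {}"
      by (rule infinite_imp_nonempty)
    then show ?thesis by blast
  qed
  then obtain e where e: "\<And>n. e n \<in> a n \<inter> B" "\<And>n j. j < n \<Longrightarrow> e n \<notin> a j"
    by metis
  have "inj e"
    by (rule linorder_injI) (metis IntD1 e)
  then have E: "infinite (range e)"
    by (simp add: range_inj_infinite)
  have fin_a: "finite (range e \<inter> a n)" for n
  proof (rule finite_subset)
    \<comment> \<open>Only \<open>e 0, ..., e n\<close> can lie in \<open>a n\<close>; later points
      avoid it by choice.\<close>
    show "range e \<inter> a n \<subseteq> e ` {..n}"
      using e(2)[of n] by (force simp: not_less[symmetric])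
  qed simp
  have fin: "finite (range e \<inter> A)" if "A \<in> F" for A
  proof (cases "A \<in> ?G")
    case True
    then obtain n where "A = a n"
      using a by (metis bij_betw_imp_surj_on imageE)
    then show ?thesis using fin_a by simp
  next
    case False
    then have "finite (A \<inter> B)"
      using that by simp
    then show ?thesis
      by (rule finite_subset[rotated]) (use e(1) in auto)
  qed
  have "almost_disjoint_family (insert (range e) F)"
    unfolding almost_disjoint_family_def
    using ad E fin by (auto simp: Int_commute)
  then have "insert (range e) F = F"
    using F unfolding mad_family_def by blast
  then have "range e \<in> F" by blast
  \<comment> \<open>As a member of \<open>F\<close>, the infinite set \<open>range e\<close> would
    have finite intersection with itself.\<close>
  then show False
    using fin[of "range e"] E by simp
qed

text \<open>
  Rosenthal's lemma, after Kuo: if no block of a partition of \<open>D\<close> into infinite sets works, then a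
  transversal of bad indices is a set on which the uniform bound has dropped by a fixed amount.
\<close>

lemma rosenthal_disjointness:
  fixes \<phi> :: "'k \<Rightarrow> ('k \<Rightarrow> real) \<Rightarrow> real" and N :: nat and d :: real
  assumes "infinite D" "countable D"
    and add: "\<And>\<eta> x y. \<lbrakk>\<eta> \<in> D; bounded (range x); bounded (range y); {k. x k \<noteq> 0} \<subseteq> D; {k. y k \<noteq> 0} \<subseteq> D\<rbrakk>
      \<Longrightarrow> \<phi> \<eta> (\<lambda>k. x k + y k) = \<phi> \<eta> x + \<phi> \<eta> y"
    and scale: "\<And>\<eta> c x. \<lbrakk>\<eta> \<in> D; bounded (range x); {k. x k \<noteq> 0} \<subseteq> D\<rbrakk>
      \<Longrightarrow> \<phi> \<eta> (\<lambda>k. c * x k) = c * \<phi> \<eta> x"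
    and bound: "\<And>\<eta> x. \<lbrakk>\<eta> \<in> D; \<And>k. \<bar>x k\<bar> \<le> 1; {k. x k \<noteq> 0} \<subseteq> D - {\<eta>}\<rbrakk> \<Longrightarrow> \<phi> \<eta> x \<le> N * d"
    and "0 < d"
  obtains D' where "D' \<subseteq> D" "infinite D'"
    "\<And>\<eta>. \<eta> \<in> D' \<Longrightarrow> \<bar>\<phi> \<eta> (indicat_real (D' - {\<eta>}))\<bar> < d"
proof -
  have bdd: "bounded (range x)" if "\<And>k. \<bar>x k\<bar> \<le> 1" for x :: "'k \<Rightarrow> real"
    using that by (auto simp: bounded_iff)
  \<comment> \<open>Induction on the bound in units of \<open>d\<close>, generalised to the infinite
    subsets of \<open>D\<close>; each failure lowers the bound by one unit.\<close>
  have "\<exists>D'\<subseteq>E. infinite D' \<and> (\<forall>\<eta>\<in>D'. \<bar>\<phi> \<eta> (indicat_real (D' - {\<eta>}))\<bar> < d)"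
    if "E \<subseteq> D" "infinite E"
      "\<And>\<eta> x. \<lbrakk>\<eta> \<in> E; \<And>k. \<bar>x k\<bar> \<le> 1; {k. x k \<noteq> 0} \<subseteq> E - {\<eta>}\<rbrakk> \<Longrightarrow> \<phi> \<eta> x \<le> N * d" for E
    using that
  proof (induction N arbitrary: E)
    case 0
    \<comment> \<open>The bound \<open>0\<close>, applied to the indicator and to its negative,
      forces the value \<open>0\<close>.\<close>
    have "\<phi> \<eta> (indicat_real (E - {\<eta>})) = 0" if "\<eta> \<in> E" for \<eta>
    proof -
      have "\<phi> \<eta> (indicat_real (E - {\<eta>})) \<le> 0"
        by (rule order_trans[OF "0.prems"(3)[OF that]]) (auto simp: indicator_def)
      moreover have "\<phi> \<eta> (\<lambda>k. - 1 * indicat_real (E - {\<eta>}) k) \<le> 0"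
        by (rule order_trans[OF "0.prems"(3)[OF that]]) (auto simp: indicator_def)
      moreover have "\<phi> \<eta> (\<lambda>k. - 1 * indicat_real (E - {\<eta>}) k) = - 1 * \<phi> \<eta> (indicat_real (E - {\<eta>}))"
        using "0.prems"(1) that by (intro scale bdd) (auto simp: indicator_def)
      ultimately show ?thesis by linarith
    qed
    then show ?case
      using "0.prems"(2) \<open>0 < d\<close> by (intro exI[of _ E]) auto
  next
    case (Suc N)
    have "countable E"
      using Suc.prems(1) \<open>countable D\<close> by (rule countable_subset)
    then have bij: "bij_betw (from_nat_into E) UNIV E"
      using Suc.prems(2) by (rule bij_betw_from_nat_into)
    \<comment> \<open>The ranges of \<open>e 0, e 1, ...\<close> partition \<open>E\<close> into
      infinitely many infinite blocks.\<close>
    define e where "e i j = from_nat_into E (prod_encode (i, j))" for i j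
    have e_eq: "e i j = e i' j' \<longleftrightarrow> i = i' \<and> j = j'" for i j i' j'
      using bij_betw_imp_inj_on[OF bij] by (auto simp: e_def dest: injD)
    have e_in: "e i j \<in> E" for i j
      using bij_betwE[OF bij] by (simp add: e_def)
    have inf: "infinite (range (e i))" for i
      by (intro range_inj_infinite injI) (simp add: e_eq)
    show ?case
    proof (cases "\<exists>i. \<forall>\<eta>\<in>range (e i). \<bar>\<phi> \<eta> (indicat_real (range (e i) - {\<eta>}))\<bar> < d")
      case True
      then obtain i where i: "\<forall>\<eta>\<in>range (e i). \<bar>\<phi> \<eta> (indicat_real (range (e i) - {\<eta>}))\<bar> < d" ..
      have "range (e i) \<subseteq> E"
        using e_in by blast
      with i inf[of i] show ?thesis
        by blast
    next
      case False
      have "\<exists>j. d \<le> \<bar>\<phi> (e i j) (indicat_real (range (e i) - {e i j}))\<bar>" for i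
        using False by (force simp: not_less)
      then obtain j where j: "\<And>i. d \<le> \<bar>\<phi> (e i (j i)) (indicat_real (range (e i) - {e i (j i)}))\<bar>"
        by metis
      \<comment> \<open>One bad index from each block.\<close>
      define E' where "E' = range (\<lambda>i. e i (j i))"
      have E': "E' \<subseteq> E"
        using e_in by (auto simp: E'_def)
      have "\<exists>D'\<subseteq>E'. infinite D' \<and> (\<forall>\<eta>\<in>D'. \<bar>\<phi> \<eta> (indicat_real (D' - {\<eta>}))\<bar> < d)"
      proof (rule Suc.IH)
        show "E' \<subseteq> D" using E' Suc.prems(1) by blast
        show "infinite E'"
          unfolding E'_def by (intro range_inj_infinite injI) (simp add: e_eq)
      next
        fix \<eta> x assume \<eta>: "\<eta> \<in> E'" and x: "\<And>k. \<bar>x k\<bar> \<le> (1::real)" "{k. x k \<noteq> 0} \<subseteq> E' - {\<eta>}"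
        obtain i where i: "\<eta> = e i (j i)"
          using \<eta> by (auto simp: E'_def)
        define y where "y = indicat_real (range (e i) - {\<eta>})"
        have y01: "\<bar>y k\<bar> \<le> 1" for k
          by (simp add: y_def indicator_def)
        have y_supp: "{k. y k \<noteq> 0} \<subseteq> E - {\<eta>}"
          using e_in by (auto simp: y_def indicator_def)
        \<comment> \<open>With this sign the block contributes \<open>|\<phi> \<eta> y|\<close>,
          which is at least \<open>d\<close> because \<open>\<eta>\<close> is bad for its
          block.\<close>
        define s where "s = sgn (\<phi> \<eta> y)"
        \<comment> \<open>\<open>E'\<close> meets block \<open>i\<close> only in
          \<open>\<eta>\<close>, so \<open>x\<close> and \<open>y\<close> have disjoint supports and
          \<open>x + s * y\<close> still has modulus at most \<open>1\<close>. The bound for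
          \<open>E\<close> then applies to it, and subtracting the contribution \<open>d\<close>
          leaves \<open>N * d\<close> for \<open>x\<close>.\<close>
        have disj: "x k = 0 \<or> y k = 0" for k
        proof -
          have False if "k \<in> E' - {\<eta>}" "k \<in> range (e i) - {\<eta>}"
            using that i by (auto simp: E'_def e_eq)
          then show ?thesis
            using x(2) by (auto simp: y_def indicator_def)
        qed
        have \<eta>D: "\<eta> \<in> E" "\<eta> \<in> D" and x_supp: "{k. x k \<noteq> 0} \<subseteq> E - {\<eta>}"
          using \<eta> E' Suc.prems(1) x(2) by auto
        have sy: "\<bar>s * y k\<bar> \<le> 1" for k
          using y01[of k] by (auto simp: s_def abs_mult sgn_if)
        have "\<phi> \<eta> (\<lambda>k. x k + s * y k) \<le> Suc N * d"
        proof (rule Suc.prems(3)[OF \<eta>D(1)])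
          show "\<bar>x k + s * y k\<bar> \<le> 1" for k
            using disj[of k] x(1)[of k] sy[of k] by auto
          have "{k. x k + s * y k \<noteq> 0} \<subseteq> {k. x k \<noteq> 0} \<union> {k. y k \<noteq> 0}"
            by auto
          then show "{k. x k + s * y k \<noteq> 0} \<subseteq> E - {\<eta>}"
            using x_supp y_supp by blast
        qed
        moreover have "\<phi> \<eta> (\<lambda>k. x k + s * y k) = \<phi> \<eta> x + \<phi> \<eta> (\<lambda>k. s * y k)"
          using x_supp y_supp Suc.prems(1) by (intro add \<eta>D bdd x(1) sy) auto
        moreover have "\<phi> \<eta> (\<lambda>k. s * y k) = s * \<phi> \<eta> y"
          using y_supp Suc.prems(1) by (intro scale \<eta>D bdd y01) auto
        moreover have "s * \<phi> \<eta> y = \<bar>\<phi> \<eta> y\<bar>"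
          by (simp add: s_def abs_sgn mult.commute)
        moreover have "d \<le> \<bar>\<phi> \<eta> y\<bar>"
          using j[of i] by (simp add: y_def i)
        ultimately show "\<phi> \<eta> x \<le> N * d"
          by (simp add: algebra_simps)
      qed
      then show ?thesis using E' by blast
    qed
  qed
  from this[OF order_refl \<open>infinite D\<close>] bound obtain D' where "D' \<subseteq> D" "infinite D'"
    "\<forall>\<eta>\<in>D'. \<bar>\<phi> \<eta> (indicat_real (D' - {\<eta>}))\<bar> < d"
    by blast
  then show ?thesis
    by (intro that[of D']) auto
qed


section \<open>Operators from \<open>\<ell>\<^sub>\<infinity>\<^sup>c\<close> to \<open>C(\<nat>\<^sup>*)\<close>\<close>

lemma nrm_sup_norm_space [simp]: "nrm (sup_norm_space V) f = (SUP k. \<bar>f k\<bar>)"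
  and carrier_sup_norm_space [simp]: "carrier (sup_norm_space V) = V"
  and add_sup_norm_space [simp]: "add (sup_norm_space V) = (\<lambda>f g k. f k + g k)"
  and zero_sup_norm_space [simp]: "zero (sup_norm_space V) = (\<lambda>_. 0)"
  and smult_sup_norm_space [simp]: "smult (sup_norm_space V) = (\<lambda>c f k. c * f k)"
  by (simp_all add: sup_norm_space_def)

lemma bounded_range_bdd_above_abs:
  fixes f :: "'k \<Rightarrow> real"
  shows "bounded (range f) \<longleftrightarrow> bdd_above (range (\<lambda>k. \<bar>f k\<bar>))"
  by (auto simp: bounded_iff bdd_above_def)

lemma abs_le_SUP_abs:
  fixes f :: "'k \<Rightarrow> real"
  assumes "bounded (range f)"
  shows "\<bar>f k\<bar> \<le> (SUP k. \<bar>f k\<bar>)"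
  using assms by (intro cSUP_upper) (auto simp: bounded_range_bdd_above_abs)

lemma SUP_abs_le:
  fixes f :: "'k \<Rightarrow> real"
  assumes "\<And>k. \<bar>f k\<bar> \<le> c"
  shows "(SUP k. \<bar>f k\<bar>) \<le> c"
  using assms by (intro cSUP_least) auto

text \<open>A type is never empty, so the value at the index \<open>undefined\<close> bounds the
  supremum from below.\<close>

lemma SUP_abs_nonneg: "bounded (range f) \<Longrightarrow> 0 \<le> (SUP k. \<bar>f k :: real\<bar>)"
  using abs_le_SUP_abs[of f undefined] by (auto intro: order_trans[rotated])

lemma bounded_scale:
  fixes g :: "'k \<Rightarrow> real"
  shows "bounded (range g) \<Longrightarrow> bounded (range (\<lambda>n. c * g n))"
  using bounded_scaling[of "range g" c] by (simp add: image_image)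

lemma carrier_linf [simp]: "f \<in> carrier (linf K) \<longleftrightarrow> (\<forall>k. k \<notin> K \<longrightarrow> f k = 0) \<and> bounded (range f)"
  and nrm_linf [simp]: "nrm (linf K) f = (SUP k. \<bar>f k\<bar>)"
  and add_linf [simp]: "add (linf K) = (\<lambda>f g k. f k + g k)"
  and smult_linf [simp]: "smult (linf K) = (\<lambda>c f k. c * f k)"
  by (simp_all add: linf_def)

lemma carrier_linf_c [simp]: "f \<in> carrier (linf_c K) \<longleftrightarrow>
    (\<forall>k. k \<notin> K \<longrightarrow> f k = 0) \<and> bounded (range f) \<and> countable {k. f k \<noteq> 0}"
  and nrm_linf_c [simp]: "nrm (linf_c K) f = (SUP k. \<bar>f k\<bar>)"
  and add_linf_c [simp]: "add (linf_c K) = (\<lambda>f g k. f k + g k)"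
  and smult_linf_c [simp]: "smult (linf_c K) = (\<lambda>c f k. c * f k)"
  by (simp_all add: linf_c_def)

lemma carrier_continuous_space [simp]: "f \<in> carrier (continuous_space T) \<longleftrightarrow>
    (\<forall>p. p \<notin> topspace T \<longrightarrow> f p = 0) \<and> continuous_map T euclideanreal f"
  and nrm_continuous_space [simp]: "nrm (continuous_space T) f = (SUP k. \<bar>f k\<bar>)"
  and add_continuous_space [simp]: "add (continuous_space T) = (\<lambda>f g k. f k + g k)"
  and smult_continuous_space [simp]: "smult (continuous_space T) = (\<lambda>c f k. c * f k)"
  by (simp_all add: continuous_space_def)

lemma bounded_operatorD:
  assumes "bounded_operator X Y T"
  shows "x \<in> carrier X \<Longrightarrow> T x \<in> carrier Y"
    and "x \<in> carrier X \<Longrightarrow> y \<in> carrier X \<Longrightarrow> T (x \<oplus>\<^bsub>X\<^esub> y) = T x \<oplus>\<^bsub>Y\<^esub> T y"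
    and "x \<in> carrier X \<Longrightarrow> T (c \<odot>\<^bsub>X\<^esub> x) = c \<odot>\<^bsub>Y\<^esub> T x"
  using assms by (auto simp: bounded_operator_def)

lemma indicator_in_linf_c [simp]:
  "countable C \<Longrightarrow> C \<subseteq> K \<Longrightarrow> indicat_real C \<in> carrier (linf_c K)"
  by (auto simp: indicator_def bounded_iff)

lemma nstar_space_bounded:
  assumes "f \<in> carrier (continuous_space nstar)"
  shows "bounded (range f)"
proof -
  have "range f \<subseteq> insert 0 (f ` nstar_points)"
    using assms by auto
  then show ?thesis
    by (rule bounded_subset[rotated]) (use nstar_continuous_bounded[of f] assms in simp)
qed

text \<open>
  A bounded \<open>S\<close> sending each unit vector to the corresponding clopen set is made to take
  arbitrarily large values on indicators of countable sets: along a clopen set where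
  \<open>S 1\<^sub>C\<close> is large, the members of \<open>F\<close> outside \<open>C\<close> that it still splits are uncountably many,
  and by Rosenthal's lemma some of them can be added to \<open>C\<close> with a definite gain.
\<close>

lemma mad_family_no_operator:
  assumes F: "mad_family F" and S: "bounded_operator (linf_c F) (continuous_space nstar) S"
    and unit: "\<And>A. A \<in> F \<Longrightarrow> S (indicat_real {A}) = indicat_real (nstar_clopen A)"
  shows False
proof -
  let ?X = "linf_c F"
  have Sc: "S x \<in> carrier (continuous_space nstar)" if "x \<in> carrier ?X" for x
    using bounded_operatorD(1)[OF S that] .
  have S_add: "S (\<lambda>k. x k + y k) p = S x p + S y p" if "x \<in> carrier ?X" "y \<in> carrier ?X" for x y p
    using bounded_operatorD(2)[OF S that] by simp
  have S_scale: "S (\<lambda>k. c * x k) p = c * S x p" if "x \<in> carrier ?X" for x c p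
    using bounded_operatorD(3)[OF S that] by simp
  obtain c where c: "\<And>x. x \<in> carrier ?X \<Longrightarrow> nrm (continuous_space nstar) (S x) \<le> c * nrm ?X x"
    using S unfolding bounded_operator_def by blast
  \<comment> \<open>\<open>N\<close> measures the norm bound in units of \<open>1/2\<close>, the
    constant for which Rosenthal's lemma is used below; thus \<open>|c| \<le> N / 2\<close>.\<close>
  define N :: nat where "N = nat \<lceil>2 * \<bar>c\<bar>\<rceil>"
  have bound: "\<bar>S x p\<bar> \<le> N * (1/2)" if "x \<in> carrier ?X" "\<And>k. \<bar>x k\<bar> \<le> 1" for x p
  proof -
    have "0 \<le> (SUP k. \<bar>x k\<bar>)"
      using that(1) by (simp add: SUP_abs_nonneg)
    have "\<bar>S x p\<bar> \<le> (SUP q. \<bar>S x q\<bar>)"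
      by (intro abs_le_SUP_abs nstar_space_bounded Sc that)
    also have "\<dots> \<le> c * (SUP k. \<bar>x k\<bar>)"
      using c[OF that(1)] by simp
    also have "\<dots> \<le> \<bar>c\<bar> * 1"
      using SUP_abs_le[of x 1] that(2) \<open>0 \<le> _\<close> by (intro mult_mono) auto
    also have "\<dots> \<le> N * (1/2)"
      unfolding N_def by linarith
    finally show ?thesis .
  qed
  have "\<exists>C B. countable C \<and> C \<subseteq> F \<and> infinite {A \<in> F. infinite (A \<inter> B)} \<and>
      (\<forall>p\<in>nstar_clopen B. n * (1/4) \<le> S (indicat_real C) p)" for n :: nat
  proof (induction n)
    case 0
    have "{A \<in> F. infinite (A \<inter> UNIV)} = F" "infinite F"
      using F by (auto simp: mad_family_def almost_disjoint_family_def)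
    moreover have "S (\<lambda>k. 0) p = 0" for p
      using S_scale[of "indicat_real {}" 0 p, OF indicator_in_linf_c] by (simp add: indicator_def[abs_def])
    ultimately show ?case
      by (intro exI[of _ "{} :: nat set set"] exI[of _ "UNIV :: nat set"]) (simp add: indicator_def[abs_def])
  next
    case (Suc n)
    then obtain C B where C: "countable C" "C \<subseteq> F"
      and B: "infinite {A \<in> F. infinite (A \<inter> B)}"
      and ge: "\<forall>p\<in>nstar_clopen B. n * (1/4) \<le> S (indicat_real C) p"
      by (elim exE conjE)
    have "infinite ({A \<in> F. infinite (A \<inter> B)} - C)"
      using uncountable_minus_countable[OF mad_family_trace_uncountable[OF F B] C(1)]
        uncountable_infinite by auto
    obtain D where D: "D \<subseteq> {A \<in> F. infinite (A \<inter> B)} - C" "infinite D" "countable D"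
      using infinite_countable_subset'[OF \<open>infinite ({A \<in> F. infinite (A \<inter> B)} - C)\<close>] by (elim exE conjE)
    have "\<exists>p. p \<in> nstar_clopen (A \<inter> B)" if "A \<in> D" for A
      using D(1) that nstar_clopen_nonempty[of "A \<inter> B"] by blast
    then obtain p where p: "\<And>A. A \<in> D \<Longrightarrow> p A \<in> nstar_clopen (A \<inter> B)"
      by metis
    have in_X: "x \<in> carrier ?X" if "bounded (range x)" "{k. x k \<noteq> 0} \<subseteq> D" for x
      using that D countable_subset[OF that(2)] by auto
    obtain D' where D': "D' \<subseteq> D" "infinite D'"
      "\<And>A. A \<in> D' \<Longrightarrow> \<bar>S (indicat_real (D' - {A})) (p A)\<bar> < 1/2"
    proof (rule rosenthal_disjointness[OF D(2,3), of "\<lambda>A x. S x (p A)" N "1/2"])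
      fix A x assume x: "\<And>k. \<bar>x k\<bar> \<le> (1::real)" "{k. x k \<noteq> 0} \<subseteq> D - {A}"
      then have "bounded (range x)"
        by (auto simp: bounded_iff)
      then have "x \<in> carrier ?X"
        by (rule in_X) (use x(2) in blast)
      from bound[OF this x(1), of "p A"] show "S x (p A) \<le> N * (1/2)"
        by (rule abs_le_D1)
    qed (auto intro!: S_add S_scale in_X)
    have D'F: "countable D'" "D' \<subseteq> F"
      using D D'(1) by (auto intro: countable_subset)
    define f where "f = S (indicat_real D')"
    have f: "continuous_map nstar euclideanreal f"
      using Sc[of "indicat_real D'"] D'F by (simp add: f_def del: carrier_linf_c)
    \<comment> \<open>At \<open>p A\<close> the unit vector of \<open>A\<close> contributes exactly
      \<open>1\<close>, and the rest of \<open>D'\<close> less than \<open>1/2\<close> in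
      modulus.\<close>
    have f_ge: "1/2 \<le> f (p A)" if "A \<in> D'" for A
    proof -
      have "indicat_real D' = (\<lambda>k. indicat_real {A} k + indicat_real (D' - {A}) k)"
        using that by (auto simp: indicator_def)
      then have "f (p A) = S (indicat_real {A}) (p A) + S (indicat_real (D' - {A})) (p A)"
        unfolding f_def using that D'F
        by (simp only:) (intro S_add indicator_in_linf_c, auto intro: countable_subset)
      moreover have "S (indicat_real {A}) (p A) = 1"
        using unit[OF subsetD[OF D'F(2) that]] p[OF subsetD[OF D'(1) that]]
        by (simp add: nstar_clopen_Int)
      ultimately show ?thesis
        using D'(3)[OF that] by linarith
    qed
    \<comment> \<open>The gap between \<open>1/4\<close> and \<open>1/2\<close> leaves room for a
      clopen set: it catches every \<open>p A\<close>, and \<open>f\<close> stays above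
      \<open>1/4\<close> on it.\<close>
    obtain B' where B': "\<And>q. q \<in> nstar_points \<Longrightarrow> 1/2 \<le> f q \<Longrightarrow> q \<in> nstar_clopen B'"
      "\<And>q. q \<in> nstar_clopen B' \<Longrightarrow> 1/4 < f q"
      using nstar_clopen_between[OF f, of "1/4" "1/2"] by auto
    \<comment> \<open>The point \<open>p A\<close> witnesses that the trace of \<open>A\<close>
      survives the shrinking of \<open>B\<close>.\<close>
    have "infinite (A \<inter> (B \<inter> B'))" if "A \<in> D'" for A
    proof (rule nstar_clopen_infinite)
      have "p A \<in> nstar_clopen (A \<inter> B)"
        using p that D'(1) by blast
      moreover from this have "p A \<in> nstar_clopen B'"
        using f_ge[OF that] by (intro B') (auto simp: nstar_clopen_def)
      ultimately show "p A \<in> nstar_clopen (A \<inter> (B \<inter> B'))"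
        by (simp add: nstar_clopen_Int)
    qed
    then have "D' \<subseteq> {A \<in> F. infinite (A \<inter> (B \<inter> B'))}"
      using D'F(2) by blast
    then have "infinite {A \<in> F. infinite (A \<inter> (B \<inter> B'))}"
      using D'(2) finite_subset by blast
    moreover have "Suc n * (1/4) \<le> S (indicat_real (C \<union> D')) q" if q: "q \<in> nstar_clopen (B \<inter> B')" for q
    proof -
      have "C \<inter> D' = {}"
        using D(1) D'(1) by blast
      then have "indicat_real (C \<union> D') = (\<lambda>k. indicat_real C k + indicat_real D' k)"
        by (intro ext) (auto simp: indicator_def)
      then have "S (indicat_real (C \<union> D')) q = S (indicat_real C) q + f q"
        unfolding f_def using C D'F by (simp only:) (intro S_add indicator_in_linf_c)
      then show ?thesis
        using bspec[OF ge, of q] B'(2)[of q] q by (simp add: nstar_clopen_Int)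
    qed
    ultimately show ?case
      using C D'F by (intro exI[of _ "C \<union> D'"] exI[of _ "B \<inter> B'"]) auto
  qed
  \<comment> \<open>After \<open>2 * N + 1\<close> rounds the value is at least
    \<open>N / 2 + 1/4\<close>, beyond the bound \<open>N / 2\<close> for functions of modulus at
    most \<open>1\<close>.\<close>
  from this[of "2 * N + 1"] obtain C B where C: "countable C" "C \<subseteq> F"
    and B: "infinite {A \<in> F. infinite (A \<inter> B)}"
    and ge: "\<forall>p\<in>nstar_clopen B. (2 * N + 1 :: nat) * (1/4) \<le> S (indicat_real C) p"
    by (elim exE conjE)
  obtain A where "infinite (A \<inter> B)"
    using B by (metis (no_types, lifting) finite.emptyI Collect_empty_eq)
  then obtain p where "p \<in> nstar_clopen B"
    using nstar_clopen_nonempty[of B] by auto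
  with ge have "(2 * N + 1 :: nat) * (1/4) \<le> S (indicat_real C) p"
    by (rule bspec)
  moreover have "\<bar>S (indicat_real C) p\<bar> \<le> N * (1/2)"
    using C by (intro bound indicator_in_linf_c) (auto simp: indicator_def)
  ultimately show False
    by simp
qed


section \<open>The Banach spaces \<open>c\<^sub>0\<close> and \<open>\<ell>\<^sub>\<infinity>\<^sup>c\<close>\<close>

lemma real_ring_cring: "cring real_ring"
proof (rule cringI)
  show "abelian_group real_ring"
  proof (rule abelian_groupI)
    fix x assume "x \<in> carrier real_ring"
    show "\<exists>y\<in>carrier real_ring. y \<oplus>\<^bsub>real_ring\<^esub> x = \<zero>\<^bsub>real_ring\<^esub>"
      by (intro bexI[of _ "- x"]) (auto simp: real_ring_def)
  qed (auto simp: real_ring_def)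
  show "comm_monoid real_ring"
    by (rule comm_monoidI) (auto simp: real_ring_def)
qed (auto simp: real_ring_def algebra_simps)

text \<open>The assumption \<open>closed\<close> says that uniform limits stay in \<open>V\<close>.
  A Cauchy sequence converges pointwise by completeness of the reals, and the Cauchy condition makes
  this convergence uniform.\<close>

lemma sup_norm_space_banach:
  fixes V :: "('k \<Rightarrow> real) set"
  assumes zero: "(\<lambda>_. 0) \<in> V"
    and add: "\<And>f g. f \<in> V \<Longrightarrow> g \<in> V \<Longrightarrow> (\<lambda>k. f k + g k) \<in> V"
    and scale: "\<And>c f. f \<in> V \<Longrightarrow> (\<lambda>k. c * f k) \<in> V"
    and bounded: "\<And>f. f \<in> V \<Longrightarrow> bounded (range f)"
    and closed: "\<And>f. (\<And>e. 0 < e \<Longrightarrow> \<exists>g\<in>V. \<forall>k. \<bar>g k - f k\<bar> \<le> e) \<Longrightarrow> f \<in> V"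
  shows "banach_space (sup_norm_space V)"
proof -
  let ?X = "sup_norm_space V"
  have neg: "(\<lambda>k. - f k) \<in> V" if "f \<in> V" for f
    using scale[OF that, of "-1"] by simp
  have grp: "abelian_group ?X"
  proof (rule abelian_groupI)
    fix f assume "f \<in> carrier ?X"
    then show "\<exists>g\<in>carrier ?X. g \<oplus>\<^bsub>?X\<^esub> f = \<zero>\<^bsub>?X\<^esub>"
      using neg[of f] by (intro bexI[of _ "\<lambda>k. - f k"]) auto
  qed (auto simp: zero add algebra_simps)
  have minus: "f \<ominus>\<^bsub>?X\<^esub> g = (\<lambda>k. f k - g k)" if "f \<in> V" "g \<in> V" for f g
  proof -
    have "\<ominus>\<^bsub>?X\<^esub> g = (\<lambda>k. - g k)"
      using that neg by (intro abelian_group.minus_equality[OF grp]) auto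
    then show ?thesis
      by (simp add: a_minus_def)
  qed
  have "module real_ring ?X"
    by (rule moduleI[OF real_ring_cring grp])
      (auto simp: scale real_ring_def algebra_simps)
  moreover have "real_normed_space_axioms ?X"
  proof
    fix f assume "f \<in> carrier ?X"
    then have f: "f \<in> V" by simp
    have le: "\<bar>f k\<bar> \<le> nrm ?X f" for k
      using abs_le_SUP_abs[OF bounded[OF f]] by simp
    show "0 \<le> nrm ?X f"
      using le[of undefined] by linarith
    show "nrm ?X f = 0 \<longleftrightarrow> f = \<zero>\<^bsub>?X\<^esub>"
    proof
      assume "nrm ?X f = 0"
      then have "f k = 0" for k
        using le[of k] by simp
      then show "f = \<zero>\<^bsub>?X\<^esub>" by auto
    qed simp
    show "nrm ?X (f \<oplus>\<^bsub>?X\<^esub> g) \<le> nrm ?X f + nrm ?X g" if "g \<in> carrier ?X" for g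
    proof -
      have "\<bar>f k + g k\<bar> \<le> nrm ?X f + nrm ?X g" for k
        using le[of k] abs_le_SUP_abs[OF bounded, of g k] that by simp
      then show ?thesis
        by (simp add: SUP_abs_le)
    qed
    show "nrm ?X (c \<odot>\<^bsub>?X\<^esub> f) = \<bar>c\<bar> * nrm ?X f" for c
    \<comment> \<open>The reverse inequality is obtained by dividing by \<open>|c|\<close>.\<close>
    proof (cases "c = 0")
      case False
      have "nrm ?X (c \<odot>\<^bsub>?X\<^esub> f) \<le> \<bar>c\<bar> * nrm ?X f"
      proof -
        have "\<bar>c * f k\<bar> \<le> \<bar>c\<bar> * nrm ?X f" for k
          using le[of k] by (simp add: abs_mult mult_left_mono)
        then show ?thesis
          by (simp only: smult_sup_norm_space nrm_sup_norm_space SUP_abs_le)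
      qed
      moreover have "nrm ?X f \<le> nrm ?X (c \<odot>\<^bsub>?X\<^esub> f) / \<bar>c\<bar>"
      proof -
        have "\<bar>c * f k\<bar> \<le> nrm ?X (c \<odot>\<^bsub>?X\<^esub> f)" for k
          using abs_le_SUP_abs[OF bounded[OF scale[OF f]], of c k] by simp
        then have "\<bar>f k\<bar> \<le> nrm ?X (c \<odot>\<^bsub>?X\<^esub> f) / \<bar>c\<bar>" for k
          using False by (simp add: pos_le_divide_eq mult.commute[of _ "\<bar>c\<bar>"] flip: abs_mult)
        then show ?thesis
          by (simp only: nrm_sup_norm_space SUP_abs_le)
      qed
      ultimately show ?thesis
        using False by (simp add: field_simps)
    qed simp
  qed
  moreover have "banach_space_axioms ?X"
  proof
    fix s :: "nat \<Rightarrow> 'k \<Rightarrow> real"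
    assume "range s \<subseteq> carrier ?X"
      and cauchy: "\<forall>e>0. \<exists>N. \<forall>m\<ge>N. \<forall>n\<ge>N. nrm ?X (s m \<ominus>\<^bsub>?X\<^esub> s n) < e"
    then have s: "s n \<in> V" for n
      by auto
    have le: "\<bar>s m k - s n k\<bar> \<le> nrm ?X (s m \<ominus>\<^bsub>?X\<^esub> s n)" for m n k
    proof -
      have "bounded (range (\<lambda>k. s m k - s n k))"
        using bounded[OF add[OF s neg[OF s]]] by simp
      from abs_le_SUP_abs[OF this, of k] show ?thesis
        by (simp add: minus s)
    qed
    have unif: "\<exists>N. \<forall>m\<ge>N. \<forall>n\<ge>N. \<forall>k. \<bar>s m k - s n k\<bar> < e" if "0 < e" for e
      using cauchy that le by (meson le_less_trans)
    have "Cauchy (\<lambda>n. s n k)" for k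
      using unif by (fastforce simp: Cauchy_def dist_real_def)
    then have "convergent (\<lambda>n. s n k)" for k
      by (rule Cauchy_convergent)
    then obtain f where f: "\<And>k. (\<lambda>n. s n k) \<longlonglongrightarrow> f k"
      unfolding convergent_def by metis
    have lim: "\<exists>N. \<forall>n\<ge>N. \<forall>k. \<bar>s n k - f k\<bar> \<le> e" if "0 < e" for e
    proof -
      obtain N where N: "\<And>m n k. m \<ge> N \<Longrightarrow> n \<ge> N \<Longrightarrow> \<bar>s m k - s n k\<bar> < e"
        using unif[OF \<open>0 < e\<close>] by blast
      \<comment> \<open>Letting \<open>m\<close> tend to infinity turns the strict Cauchy estimate
        into a weak one; this is why \<open>e / 2\<close> is taken further down.\<close>
      have "\<bar>s n k - f k\<bar> \<le> e" if "n \<ge> N" for n k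
      proof (rule tendsto_upperbound)
        show "(\<lambda>m. \<bar>s n k - s m k\<bar>) \<longlonglongrightarrow> \<bar>s n k - f k\<bar>"
          by (intro tendsto_intros f)
        show "\<forall>\<^sub>F m in sequentially. \<bar>s n k - s m k\<bar> \<le> e"
          using N[OF that] by (auto simp: eventually_sequentially intro!: exI[of _ N] less_imp_le)
      qed simp
      then show ?thesis by blast
    qed
    have fV: "f \<in> V"
      using lim s by (intro closed) blast
    moreover have "(\<lambda>n. nrm ?X (s n \<ominus>\<^bsub>?X\<^esub> f)) \<longlonglongrightarrow> 0"
    proof (rule LIMSEQ_I)
      fix e :: real assume "0 < e"
      then obtain N where N: "\<And>n k. n \<ge> N \<Longrightarrow> \<bar>s n k - f k\<bar> \<le> e / 2"
        using lim[of "e / 2"] by auto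
      have "norm (nrm ?X (s n \<ominus>\<^bsub>?X\<^esub> f) - 0) < e" if "n \<ge> N" for n
      proof -
        have "nrm ?X (s n \<ominus>\<^bsub>?X\<^esub> f) \<le> e / 2"
          unfolding minus[OF s fV] nrm_sup_norm_space by (intro SUP_abs_le N that)
        moreover have "0 \<le> nrm ?X (s n \<ominus>\<^bsub>?X\<^esub> f)"
        proof -
          have "bounded (range (\<lambda>k. s n k - f k))"
            using bounded[OF add[OF s neg[OF fV]]] by simp
          from abs_le_SUP_abs[OF this, of undefined] show ?thesis
            by (simp add: minus s fV)
        qed
        ultimately show ?thesis
          using \<open>0 < e\<close> by simp
      qed
      then show "\<exists>N. \<forall>n\<ge>N. norm (nrm ?X (s n \<ominus>\<^bsub>?X\<^esub> f) - 0) < e"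
        by blast
    qed
    ultimately show "\<exists>f\<in>carrier ?X. (\<lambda>n. nrm ?X (s n \<ominus>\<^bsub>?X\<^esub> f)) \<longlonglongrightarrow> 0"
      by auto
  qed
  ultimately show ?thesis
    by (intro banach_space.intro real_normed_space.intro)
qed

lemma carrier_c0 [simp]: "f \<in> carrier (c0 K) \<longleftrightarrow>
    (\<forall>k. k \<notin> K \<longrightarrow> f k = 0) \<and> (\<forall>e>0. finite {k. e \<le> \<bar>f k\<bar>})"
  and nrm_c0 [simp]: "nrm (c0 K) f = (SUP k. \<bar>f k\<bar>)"
  and add_c0 [simp]: "add (c0 K) = (\<lambda>f g k. f k + g k)"
  and smult_c0 [simp]: "smult (c0 K) = (\<lambda>c f k. c * f k)"
  by (simp_all add: c0_def)

lemma c0_bounded: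
  assumes "f \<in> carrier (c0 K)"
  shows "bounded (range f)"
proof -
  have "finite (f ` {k. 1 \<le> \<bar>f k\<bar>})"
    using assms by simp
  then have "bounded (f ` {k. 1 \<le> \<bar>f k\<bar>} \<union> {-1..1})"
    by (simp add: finite_imp_bounded)
  then show ?thesis
    by (rule bounded_subset) auto
qed

lemma c0_countable_support:
  fixes f :: "'k \<Rightarrow> real"
  assumes "f \<in> carrier (c0 K)"
  shows "countable {k. f k \<noteq> 0}"
proof -
  have "{k. f k \<noteq> 0} \<subseteq> (\<Union>n. {k. inverse (real (Suc n)) \<le> \<bar>f k\<bar>})"
  proof
    fix k assume "k \<in> {k. f k \<noteq> 0}"
    then obtain n where "inverse (real (Suc n)) < \<bar>f k\<bar>"
      using reals_Archimedean[of "\<bar>f k\<bar>"] by auto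
    then show "k \<in> (\<Union>n. {k. inverse (real (Suc n)) \<le> \<bar>f k\<bar>})"
      by (intro UN_I[of n]) auto
  qed
  moreover have "countable (\<Union>n. {k. inverse (real (Suc n)) \<le> \<bar>f k\<bar>})"
  proof (rule countable_UN)
    show "countable {k. inverse (real (Suc n)) \<le> \<bar>f k\<bar>}" for n
      by (rule countable_finite, rule assms[unfolded carrier_c0, THEN conjunct2, rule_format]) simp
  qed auto
  ultimately show ?thesis
    by (rule countable_subset)
qed

lemma c0_subset_linf_c: "carrier (c0 K) \<subseteq> carrier (linf_c K)"
  using c0_bounded[of _ K] c0_countable_support[of _ K] by auto

text \<open>Serves to show that uniform limits of functions vanishing off \<open>K\<close> vanish
  off \<open>K\<close>.\<close>

lemma approx_zero:
  fixes f :: "'k \<Rightarrow> real"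
  assumes "\<And>e. 0 < e \<Longrightarrow> \<exists>g. g k = 0 \<and> (\<forall>k. \<bar>g k - f k\<bar> \<le> e)"
  shows "f k = 0"
proof -
  have "\<bar>f k\<bar> \<le> e" if "0 < e" for e
  proof -
    obtain g where "g k = 0" "\<And>k. \<bar>g k - f k\<bar> \<le> e"
      using assms[OF \<open>0 < e\<close>] by blast
    then show ?thesis
      using that by (metis abs_minus_cancel diff_0)
  qed
  then have "\<bar>f k\<bar> \<le> 0"
    by (rule field_le_epsilon) simp
  then show ?thesis by simp
qed

lemma linf_c_banach: "banach_space (linf_c (K :: 'k set))"
proof -
  let ?V = "carrier (linf_c K)"
  have "banach_space (sup_norm_space ?V)"
  proof (rule sup_norm_space_banach)
    fix f g assume f: "f \<in> ?V" and g: "g \<in> ?V"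
    have "countable {k. f k + g k \<noteq> 0}"
      by (rule countable_subset[of _ "{k. f k \<noteq> 0} \<union> {k. g k \<noteq> 0}"]) (use f g in auto)
    then show "(\<lambda>k. f k + g k) \<in> ?V"
      using f g by (auto intro!: bounded_plus_comp)
  next
    fix c f assume f: "f \<in> ?V"
    have "countable {k. c * f k \<noteq> 0}"
      by (rule countable_subset[of _ "{k. f k \<noteq> 0}"]) (use f in auto)
    moreover have "bounded (range (\<lambda>k. c * f k))"
      using f by (simp add: bounded_scale)
    ultimately show "(\<lambda>k. c * f k) \<in> ?V"
      using f by simp
  next
    fix f :: "'k \<Rightarrow> real"
    assume f: "\<And>e. 0 < e \<Longrightarrow> \<exists>g\<in>?V. \<forall>k. \<bar>g k - f k\<bar> \<le> e"
    have "f k = 0" if "k \<notin> K" for k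
    proof (rule approx_zero[where f = f and k = k])
      fix e :: real assume "0 < e"
      then obtain g where "g \<in> ?V" "\<forall>k. \<bar>g k - f k\<bar> \<le> e"
        using f by blast
      then show "\<exists>g. g k = 0 \<and> (\<forall>k. \<bar>g k - f k\<bar> \<le> e)"
        using \<open>k \<notin> K\<close> by (intro exI[of _ g]) simp
    qed
    moreover have "bounded (range f)"
    proof -
      obtain g where g: "g \<in> ?V" "\<forall>k. \<bar>g k - f k\<bar> \<le> 1"
        using f[OF zero_less_one] by blast
      then have "bounded (range g)"
        by simp
      then have "\<bar>f k\<bar> \<le> (SUP k. \<bar>g k\<bar>) + 1" for k
        using spec[OF g(2), of k] abs_le_SUP_abs[of g k] by linarith
      then show ?thesis
        by (auto simp: bounded_iff)
    qed
    moreover have "countable {k. f k \<noteq> 0}"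
    proof -
      have "\<exists>g\<in>?V. \<forall>k. \<bar>g k - f k\<bar> \<le> inverse (real (Suc n))" for n
        by (rule f) simp
      then obtain g where g: "\<And>n. g n \<in> ?V" "\<And>n k. \<bar>g n k - f k\<bar> \<le> inverse (real (Suc n))"
        by metis
      \<comment> \<open>Where \<open>|f k|\<close> exceeds the approximation error of
        \<open>g n\<close>, the function \<open>g n\<close> cannot vanish. So the support of
        \<open>f\<close> lies in a countable union of countable supports.\<close>
      have "{k. f k \<noteq> 0} \<subseteq> (\<Union>n. {k. g n k \<noteq> 0})"
      proof
        fix k assume "k \<in> {k. f k \<noteq> 0}"
        then obtain n where "inverse (real (Suc n)) < \<bar>f k\<bar>"
          using reals_Archimedean[of "\<bar>f k\<bar>"] by auto
        then have "g n k \<noteq> 0"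
          using g(2)[of n k] by auto
        then show "k \<in> (\<Union>n. {k. g n k \<noteq> 0})" by blast
      qed
      then show ?thesis
        using g(1) by (auto intro: countable_subset)
    qed
    ultimately show "f \<in> ?V" by simp
  qed auto
  moreover have "sup_norm_space ?V = linf_c K"
    by (simp add: linf_c_def)
  ultimately show ?thesis by simp
qed

lemma c0_banach: "banach_space (c0 (K :: 'k set))"
proof -
  let ?V = "carrier (c0 K)"
  have "banach_space (sup_norm_space ?V)"
  proof (rule sup_norm_space_banach)
    fix f g assume f: "f \<in> ?V" and g: "g \<in> ?V"
    have "finite {k. e \<le> \<bar>f k + g k\<bar>}" if "0 < e" for e
    proof (rule finite_subset)
      show "{k. e \<le> \<bar>f k + g k\<bar>} \<subseteq> {k. e / 2 \<le> \<bar>f k\<bar>} \<union> {k. e / 2 \<le> \<bar>g k\<bar>}"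
        by (auto simp del: divide_le_eq_numeral1)
      show "finite ({k. e / 2 \<le> \<bar>f k\<bar>} \<union> {k. e / 2 \<le> \<bar>g k\<bar>})"
        using f g half_gt_zero[OF that] unfolding carrier_c0 by blast
    qed
    then show "(\<lambda>k. f k + g k) \<in> ?V"
      using f g by auto
  next
    fix c f assume f: "f \<in> ?V"
    have "finite {k. e \<le> \<bar>c * f k\<bar>}" if "0 < e" for e
    proof (cases "c = 0")
      case False
      then have "{k. e \<le> \<bar>c * f k\<bar>} = {k. e / \<bar>c\<bar> \<le> \<bar>f k\<bar>}"
        by (auto simp: abs_mult field_simps)
      then show ?thesis using f that False by simp
    qed (use that in simp)
    then show "(\<lambda>k. c * f k) \<in> ?V"
      using f by simp
  next
    fix f :: "'k \<Rightarrow> real"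
    assume f: "\<And>e. 0 < e \<Longrightarrow> \<exists>g\<in>?V. \<forall>k. \<bar>g k - f k\<bar> \<le> e"
    have "f k = 0" if "k \<notin> K" for k
    proof (rule approx_zero[where f = f and k = k])
      fix e :: real assume "0 < e"
      then obtain g where "g \<in> ?V" "\<forall>k. \<bar>g k - f k\<bar> \<le> e"
        using f by blast
      then show "\<exists>g. g k = 0 \<and> (\<forall>k. \<bar>g k - f k\<bar> \<le> e)"
        using \<open>k \<notin> K\<close> by (intro exI[of _ g]) simp
    qed
    moreover have "finite {k. e \<le> \<bar>f k\<bar>}" if "0 < e" for e
    proof -
      obtain g where g: "g \<in> ?V" "\<And>k. \<bar>g k - f k\<bar> \<le> e / 2"
        using f[OF half_gt_zero[OF \<open>0 < e\<close>]] by blast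
      have "{k. e \<le> \<bar>f k\<bar>} \<subseteq> {k. e / 2 \<le> \<bar>g k\<bar>}"
      proof
        fix k assume "k \<in> {k. e \<le> \<bar>f k\<bar>}"
        then have "e / 2 \<le> \<bar>g k\<bar>"
          using g(2)[of k] unfolding mem_Collect_eq by linarith
        then show "k \<in> {k. e / 2 \<le> \<bar>g k\<bar>}" ..
      qed
      then show ?thesis
        using g(1) half_gt_zero[OF that] unfolding carrier_c0 by (meson finite_subset)
    qed
    ultimately show "f \<in> ?V" by simp
  qed (use c0_bounded in auto)
  moreover have "sup_norm_space ?V = c0 K"
    by (simp add: c0_def)
  ultimately show ?thesis by simp
qed

lemma c0_subspace_linf_c: "subspace_of (c0 K) (linf_c K)"
  unfolding subspace_of_def using c0_subset_linf_c by simp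

section \<open>Composition of operators and isomorphisms\<close>

lemma bounded_operator_comp:
  assumes S: "bounded_operator X Y S" and T: "bounded_operator Y Z T"
    and nonneg: "\<And>y. y \<in> carrier Y \<Longrightarrow> 0 \<le> nrm Y y"
  shows "bounded_operator X Z (T \<circ> S)"
proof -
  obtain b where b: "\<And>x. x \<in> carrier X \<Longrightarrow> nrm Y (S x) \<le> b * nrm X x"
    using S unfolding bounded_operator_def by blast
  obtain c where c: "\<And>y. y \<in> carrier Y \<Longrightarrow> nrm Z (T y) \<le> c * nrm Y y"
    using T unfolding bounded_operator_def by blast
  \<comment> \<open>The definition of boundedness allows a negative constant \<open>c\<close>.
    Passing to \<open>|c|\<close> makes multiplication monotone, and is justified by the nonnegative
    norm of \<open>Y\<close>.\<close>
  have "nrm Z (T (S x)) \<le> (\<bar>c\<bar> * b) * nrm X x" if "x \<in> carrier X" for x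
  proof -
    have Sx: "S x \<in> carrier Y"
      by (rule bounded_operatorD(1)[OF S that])
    have "nrm Z (T (S x)) \<le> c * nrm Y (S x)"
      by (rule c[OF Sx])
    also have "\<dots> \<le> \<bar>c\<bar> * nrm Y (S x)"
      using nonneg[OF Sx] by (intro mult_right_mono) auto
    also have "\<dots> \<le> \<bar>c\<bar> * (b * nrm X x)"
      using b[OF that] by (intro mult_left_mono) auto
    finally show ?thesis by simp
  qed
  then show ?thesis
    using bounded_operatorD[OF S] bounded_operatorD[OF T]
    unfolding bounded_operator_def by (auto intro!: exI[of _ "\<bar>c\<bar> * b"])
qed

text \<open>Isomorphism is defined through \<open>inv_into\<close>, which is compared with
  \<open>T\<close> on the carrier of \<open>Y\<close>. To rewrite it inside sums and multiples,
  closure of that carrier is first transferred from the module \<open>X\<close> along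
  \<open>S\<close> and \<open>T\<close>.\<close>

lemma isomorphic_spacesI:
  assumes "module real_ring X"
    and S: "bounded_operator X Y S" and T: "bounded_operator Y X T"
    and TS: "\<And>x. x \<in> carrier X \<Longrightarrow> T (S x) = x"
    and ST: "\<And>y. y \<in> carrier Y \<Longrightarrow> S (T y) = y"
  shows "isomorphic_spaces X Y"
proof -
  interpret module real_ring X by fact
  have bij: "bij_betw S (carrier X) (carrier Y)"
    by (rule bij_betw_byWitness[where f' = T])
      (use TS ST bounded_operatorD(1)[OF S] bounded_operatorD(1)[OF T] in auto)
  let ?U = "inv_into (carrier X) S"
  have U: "?U y = T y" if "y \<in> carrier Y" for y
    using bij ST[OF that] bounded_operatorD(1)[OF T that]
    by (metis bij_betw_imp_inj_on inv_into_f_eq)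
  have closed_add: "y \<oplus>\<^bsub>Y\<^esub> z \<in> carrier Y" if "y \<in> carrier Y" "z \<in> carrier Y" for y z
    using that bounded_operatorD[OF S] bounded_operatorD(1)[OF T] ST by (metis M.add.m_closed)
  have closed_smult: "c \<odot>\<^bsub>Y\<^esub> y \<in> carrier Y" if "y \<in> carrier Y" for y c
  proof -
    have "c \<odot>\<^bsub>X\<^esub> T y \<in> carrier X"
      using bounded_operatorD(1)[OF T that] by (intro smult_closed) (auto simp: real_ring_def)
    then show ?thesis
      using that bounded_operatorD[OF S] bounded_operatorD(1)[OF T] ST by metis
  qed
  have "bounded_operator Y X ?U"
    using T closed_add closed_smult unfolding bounded_operator_def by (simp add: U)
  with S bij show ?thesis
    unfolding isomorphic_spaces_def by blast
qed

section \<open>Change of the index set along an injection\<close>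

definition reindex :: "('k \<Rightarrow> 'l) \<Rightarrow> ('k \<Rightarrow> real) \<Rightarrow> 'l \<Rightarrow> real" where
  "reindex e f = (\<lambda>l. if l \<in> range e then f (inv_into UNIV e l) else 0)"

lemma reindex_apply [simp]: "inj e \<Longrightarrow> reindex e f (e k) = f k"
  by (simp add: reindex_def)

text \<open>Off the range of \<open>e\<close> the value is \<open>0\<close>, which accounts for
  \<open>UNIV\<close> when \<open>P 0\<close> holds. The properties \<open>P\<close> to which this
  is applied fail at \<open>0\<close>.\<close>

lemma reindex_support:
  assumes "inj e"
  shows "{l. P (reindex e f l)} \<subseteq> e ` {k. P (f k)} \<union> (if P 0 then UNIV else {})"
  using assms by (auto simp: reindex_def)

lemma bounded_reindex:
  assumes "bounded (range f)"
  shows "bounded (range (reindex e f))"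
proof (rule bounded_subset)
  show "range (reindex e f) \<subseteq> insert 0 (range f)"
    by (auto simp: reindex_def)
qed (use assms in simp)

lemma SUP_abs_reindex_le:
  assumes "bounded (range f)"
  shows "(SUP l. \<bar>reindex e f l\<bar>) \<le> (SUP k. \<bar>f k\<bar>)"
proof (rule SUP_abs_le)
  fix l
  have "\<bar>f k\<bar> \<le> (SUP k. \<bar>f k\<bar>)" for k
    by (rule abs_le_SUP_abs[OF assms])
  moreover from this[of undefined] have "0 \<le> (SUP k. \<bar>f k\<bar>)"
    by linarith
  ultimately show "\<bar>reindex e f l\<bar> \<le> (SUP k. \<bar>f k\<bar>)"
    by (simp add: reindex_def)
qed

lemma SUP_abs_comp_le:
  fixes f :: "'l \<Rightarrow> real"
  assumes "bounded (range f)"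
  shows "(SUP k. \<bar>(f \<circ> e) k\<bar>) \<le> (SUP l. \<bar>f l\<bar>)"
  by (rule SUP_abs_le) (simp add: abs_le_SUP_abs[OF assms])

lemma bounded_operator_reindex_linf_c:
  assumes "inj e"
  shows "bounded_operator (linf_c K) (linf_c (e ` K)) (reindex e)"
  unfolding bounded_operator_def
proof (intro conjI ballI allI exI[of _ 1])
  fix f assume f: "f \<in> carrier (linf_c K)"
  have "reindex e f l = 0" if "l \<notin> e ` K" for l
    using f that assms by (auto simp: reindex_def)
  moreover have "countable {l. reindex e f l \<noteq> 0}"
    by (rule countable_subset[OF reindex_support[OF assms]]) (use f in simp)
  ultimately show "reindex e f \<in> carrier (linf_c (e ` K))"
    using f by (simp add: bounded_reindex)
  show "nrm (linf_c (e ` K)) (reindex e f) \<le> 1 * nrm (linf_c K) f"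
    using f SUP_abs_reindex_le[of f e] by simp
qed (auto simp: reindex_def)

lemma bounded_operator_reindex_c0:
  assumes "inj e"
  shows "bounded_operator (c0 K) (c0 (e ` K)) (reindex e)"
  unfolding bounded_operator_def
proof (intro conjI ballI allI exI[of _ 1])
  fix f assume f: "f \<in> carrier (c0 K)"
  have "reindex e f l = 0" if "l \<notin> e ` K" for l
    using f that assms by (auto simp: reindex_def)
  moreover have "finite {l. c \<le> \<bar>reindex e f l\<bar>}" if "0 < c" for c
    by (rule finite_subset[OF reindex_support[OF assms]]) (use f that in auto)
  ultimately show "reindex e f \<in> carrier (c0 (e ` K))"
    by simp
  show "nrm (c0 (e ` K)) (reindex e f) \<le> 1 * nrm (c0 K) f"
    using SUP_abs_reindex_le[OF c0_bounded[OF f], of e] by simp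
qed (auto simp: reindex_def)

lemma bounded_operator_comp_c0:
  assumes "inj e"
  shows "bounded_operator (c0 (e ` K)) (c0 K) (\<lambda>f. f \<circ> e)"
  unfolding bounded_operator_def
proof (intro conjI ballI allI exI[of _ 1])
  fix f assume f: "f \<in> carrier (c0 (e ` K))"
  have "f (e k) = 0" if "k \<notin> K" for k
    using f that assms by (auto simp: inj_image_mem_iff)
  moreover have "finite {k. c \<le> \<bar>f (e k)\<bar>}" if "0 < c" for c
    using finite_vimageI[of "{l. c \<le> \<bar>f l\<bar>}" e] f assms that by (simp add: vimage_def)
  ultimately show "f \<circ> e \<in> carrier (c0 K)"
    by simp
  show "nrm (c0 K) (f \<circ> e) \<le> 1 * nrm (c0 (e ` K)) f"
    using SUP_abs_comp_le[OF c0_bounded[OF f], of e] by simp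
qed auto

lemma c0_reindex_isomorphic:
  assumes "inj e"
  shows "isomorphic_spaces (c0 (e ` K)) (c0 K)"
proof (rule isomorphic_spacesI)
  show "module real_ring (c0 (e ` K))"
    using c0_banach[of "e ` K"]
    by (simp add: banach_space_def real_normed_space_def)
  show "bounded_operator (c0 (e ` K)) (c0 K) (\<lambda>f. f \<circ> e)"
    using assms by (rule bounded_operator_comp_c0)
  show "bounded_operator (c0 K) (c0 (e ` K)) (reindex e)"
    using assms by (rule bounded_operator_reindex_c0)
  \<comment> \<open>Functions of this space vanish off the range of \<open>e\<close>, so composing
    with \<open>e\<close> loses nothing.\<close>
  show "reindex e (f \<circ> e) = f" if "f \<in> carrier (c0 (e ` K))" for f
    using that by (auto simp: reindex_def f_inv_into_f fun_eq_iff)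
  show "reindex e f \<circ> e = f" for f
    using assms by (simp add: fun_eq_iff)
qed


section \<open>The quotient \<open>\<ell>\<^sub>\<infinity>/c\<^sub>0\<close>\<close>

text \<open>For bounded \<open>g\<close> this is the coset of \<open>g\<close> modulo
  \<open>c_0\<close> in analytic terms; \<open>c0_coset_eq\<close> links it to the algebraic
  coset.\<close>

definition c0_coset :: "(nat \<Rightarrow> real) \<Rightarrow> (nat \<Rightarrow> real) set" where
  "c0_coset g = {h. bounded (range h) \<and> (\<lambda>n. h n - g n) \<longlonglongrightarrow> 0}"

lemma carrier_c0_UNIV: "carrier (c0 UNIV) = {f :: nat \<Rightarrow> real. f \<longlonglongrightarrow> 0}"
proof -
  have "f \<longlonglongrightarrow> 0 \<longleftrightarrow> (\<forall>e>0. finite {n. e \<le> \<bar>f n\<bar>})" for f :: "nat \<Rightarrow> real"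
    unfolding tendsto_iff
    by (simp add: cofinite_eq_sequentially[symmetric] eventually_cofinite not_less)
  then show ?thesis by auto
qed

lemma c0_coset_refl: "bounded (range g) \<Longrightarrow> g \<in> c0_coset g"
  by (simp add: c0_coset_def)

lemma c0_coset_eqI:
  assumes "(\<lambda>n. g n - h n) \<longlonglongrightarrow> 0"
  shows "c0_coset g = c0_coset h"
proof -
  have "(\<lambda>n. u n - g n) \<longlonglongrightarrow> 0 \<longleftrightarrow> (\<lambda>n. u n - h n) \<longlonglongrightarrow> 0" for u
    using tendsto_add[OF _ assms, of "\<lambda>n. u n - g n" 0] tendsto_diff[OF _ assms, of "\<lambda>n. u n - h n" 0]
    by auto
  then show ?thesis by (simp add: c0_coset_def)
qed

lemma c0_coset_eq:
  assumes "bounded (range g)"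
  shows "carrier (c0 UNIV) +>\<^bsub>linf UNIV\<^esub> g = c0_coset g"
proof -
  have "bounded (range (\<lambda>n. f n + g n))" if "f \<longlonglongrightarrow> 0" for f :: "nat \<Rightarrow> real"
    using convergent_imp_bounded[OF that] assms by (rule bounded_plus_comp)
  moreover have "\<exists>f. f \<longlonglongrightarrow> 0 \<and> h = (\<lambda>n. f n + g n)" if "(\<lambda>n. h n - g n) \<longlonglongrightarrow> 0" for h
    using that by (intro exI[of _ "\<lambda>n. h n - g n"]) simp
  ultimately show ?thesis
    by (auto simp: a_r_coset_def' carrier_c0_UNIV c0_coset_def)
qed

lemma carrier_linf_mod_c0: "carrier linf_mod_c0 = c0_coset ` {g. bounded (range g)}"
proof -
  have "carrier linf_mod_c0 = (\<lambda>g. carrier (c0 UNIV) +>\<^bsub>linf UNIV\<^esub> g) ` {g. bounded (range g)}"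
    by (auto simp: linf_mod_c0_def quotient_space_def A_RCOSETS_def')
  then show ?thesis by (simp add: c0_coset_eq)
qed

lemma add_linf_mod_c0:
  assumes "bounded (range g)" "bounded (range h)"
  shows "c0_coset g \<oplus>\<^bsub>linf_mod_c0\<^esub> c0_coset h = c0_coset (\<lambda>n. g n + h n)"
proof (intro equalityI subsetI)
  fix u assume "u \<in> c0_coset g \<oplus>\<^bsub>linf_mod_c0\<^esub> c0_coset h"
  then obtain v w where "v \<in> c0_coset g" "w \<in> c0_coset h" "u = (\<lambda>n. v n + w n)"
    by (auto simp: linf_mod_c0_def quotient_space_def set_add_def')
  then show "u \<in> c0_coset (\<lambda>n. g n + h n)"
    using tendsto_add[of "\<lambda>n. v n - g n" 0 sequentially "\<lambda>n. w n - h n" 0]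
    by (auto simp: c0_coset_def bounded_plus_comp algebra_simps)
next
  fix u assume "u \<in> c0_coset (\<lambda>n. g n + h n)"
  then have "(\<lambda>n. u n - g n) \<in> c0_coset h"
    using assms by (auto simp: c0_coset_def bounded_minus_comp algebra_simps)
  then show "u \<in> c0_coset g \<oplus>\<^bsub>linf_mod_c0\<^esub> c0_coset h"
    by (simp add: linf_mod_c0_def quotient_space_def set_add_def')
      (rule bexI[OF _ c0_coset_refl[OF assms(1)]], rule bexI[of _ "\<lambda>n. u n - g n"], auto)
qed

lemma smult_linf_mod_c0:
  assumes "bounded (range g)"
  shows "c \<odot>\<^bsub>linf_mod_c0\<^esub> c0_coset g = c0_coset (\<lambda>n. c * g n)"
proof (intro equalityI subsetI)
  fix u assume "u \<in> c \<odot>\<^bsub>linf_mod_c0\<^esub> c0_coset g"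
  then obtain v w where "v \<longlonglongrightarrow> 0" "w \<in> c0_coset g" "u = (\<lambda>n. v n + c * w n)"
    by (auto simp: linf_mod_c0_def quotient_space_def set_add_def' carrier_c0_UNIV)
  then show "u \<in> c0_coset (\<lambda>n. c * g n)"
    using tendsto_add[OF \<open>v \<longlonglongrightarrow> 0\<close> tendsto_mult_left[of "\<lambda>n. w n - g n" 0 sequentially c]]
      convergent_imp_bounded[OF \<open>v \<longlonglongrightarrow> 0\<close>]
    by (auto simp: c0_coset_def bounded_plus_comp bounded_scale algebra_simps)
next
  fix u assume "u \<in> c0_coset (\<lambda>n. c * g n)"
  then have "(\<lambda>n. u n - c * g n) \<longlonglongrightarrow> 0"
    by (simp add: c0_coset_def)
  then show "u \<in> c \<odot>\<^bsub>linf_mod_c0\<^esub> c0_coset g"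
    using c0_coset_refl[OF assms]
    by (auto simp: linf_mod_c0_def quotient_space_def set_add_def' carrier_c0_UNIV
        intro!: exI[of _ "\<lambda>n. u n - c * g n"] bexI[of _ g])
qed

lemma nrm_linf_mod_c0: "nrm linf_mod_c0 C = (INF h\<in>C. SUP n. \<bar>h n\<bar>)"
  by (simp add: linf_mod_c0_def quotient_space_def)

lemma nrm_linf_mod_c0_nonneg:
  assumes "C \<in> carrier linf_mod_c0"
  shows "0 \<le> nrm linf_mod_c0 C"
  unfolding nrm_linf_mod_c0
  using assms c0_coset_refl
  by (intro cINF_greatest) (auto simp: carrier_linf_mod_c0 c0_coset_def intro: SUP_abs_nonneg)

lemma nrm_c0_coset_le:
  assumes "bounded (range g)"
  shows "nrm linf_mod_c0 (c0_coset g) \<le> (SUP n. \<bar>g n\<bar>)"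
  unfolding nrm_linf_mod_c0
proof (rule cINF_lower)
  show "bdd_below ((\<lambda>h. SUP n. \<bar>h n\<bar>) ` c0_coset g)"
    by (intro bdd_belowI2[of _ 0]) (auto simp: c0_coset_def intro: SUP_abs_nonneg)
qed (rule c0_coset_refl[OF assms])

section \<open>The continuous extension of a bounded sequence to \<beta>\<nat>, restricted to the
  nonprincipal ultrafilters\<close>

definition nstar_extension :: "(nat \<Rightarrow> real) \<Rightarrow> nat filter \<Rightarrow> real" where
  "nstar_extension g U = (if U \<in> nstar_points then Lim U g else 0)"

lemma nstar_extension_eqI:
  assumes "U \<in> nstar_points" "(g \<longlongrightarrow> l) U"
  shows "nstar_extension g U = l"
  using assms by (auto simp: nstar_extension_def nstar_points_def ultrafilter_def intro: tendsto_Lim)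

lemma nstar_extension_tendsto:
  assumes "bounded (range g)" "U \<in> nstar_points"
  shows "(g \<longlongrightarrow> nstar_extension g U) U"
  using nstar_tendsto_Lim[OF assms] assms(2) by (simp add: nstar_extension_def)

lemma nstar_extension_le:
  assumes "bounded (range g)" "U \<in> nstar_points" "eventually (\<lambda>n. \<bar>g n - a\<bar> \<le> c) U"
  shows "\<bar>nstar_extension g U - a\<bar> \<le> c"
proof (rule tendsto_upperbound)
  show "((\<lambda>n. \<bar>g n - a\<bar>) \<longlongrightarrow> \<bar>nstar_extension g U - a\<bar>) U"
    by (intro tendsto_intros nstar_extension_tendsto assms)
  show "U \<noteq> bot"
    using assms(2) by (simp add: nstar_points_def ultrafilter_def)
qed (rule assms(3))

text \<open>A nonprincipal ultrafilter refines the cofinite filter, so null sequences tend to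
  \<open>0\<close> along it. The extension therefore depends only on the class modulo
  \<open>c_0\<close>.\<close>

lemma nstar_extension_cong:
  assumes "bounded (range g)" "(\<lambda>n. h n - g n) \<longlonglongrightarrow> 0"
  shows "nstar_extension h = nstar_extension g"
proof
  fix U
  show "nstar_extension h U = nstar_extension g U"
  proof (cases "U \<in> nstar_points")
    case True
    then have "((\<lambda>n. h n - g n) \<longlongrightarrow> 0) U"
      using assms(2) nstar_point_le_cofinite[OF True]
      by (auto simp: cofinite_eq_sequentially intro: tendsto_mono)
    from tendsto_add[OF this nstar_extension_tendsto[OF assms(1) True]]
    show ?thesis
      by (intro nstar_extension_eqI[OF True]) simp
  qed (simp add: nstar_extension_def)
qed

text \<open>The set \<open>A\<close> of those \<open>n\<close> at which \<open>g\<close> is within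
  \<open>e / 2\<close> of its limit along \<open>U\<close> yields a clopen neighbourhood of
  \<open>U\<close>, and limits along all its points stay within \<open>e / 2\<close>, hence inside
  the open ball.\<close>

lemma nstar_extension_continuous:
  assumes "bounded (range g)"
  shows "nstar_extension g \<in> carrier (continuous_space nstar)"
proof -
  have "openin nstar {U \<in> nstar_points. nstar_extension g U \<in> W}" if "open W" for W
  proof (subst openin_subopen, clarify)
    fix U assume U: "U \<in> nstar_points" "nstar_extension g U \<in> W"
    obtain e where e: "0 < e" "ball (nstar_extension g U) e \<subseteq> W"
      using \<open>open W\<close> U(2) by (meson openE)
    define A where "A = {n. \<bar>g n - nstar_extension g U\<bar> \<le> e / 2}"
    have "eventually (\<lambda>n. n \<in> A) U"
      using tendstoD[OF nstar_extension_tendsto[OF assms U(1)], of "e / 2"] e(1)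
      by (auto simp: A_def dist_real_def elim: eventually_mono)
    then have "U \<in> nstar_clopen A"
      using U(1) by (simp add: nstar_clopen_def)
    moreover have "nstar_clopen A \<subseteq> {U \<in> nstar_points. nstar_extension g U \<in> W}"
    proof
      fix V assume "V \<in> nstar_clopen A"
      then have V: "V \<in> nstar_points" "eventually (\<lambda>n. n \<in> A) V"
        by (auto simp: nstar_clopen_def)
      then have "\<bar>nstar_extension g V - nstar_extension g U\<bar> \<le> e / 2"
        by (intro nstar_extension_le assms) (auto simp: A_def)
      then show "V \<in> {U \<in> nstar_points. nstar_extension g U \<in> W}"
        using V(1) e by (auto simp: dist_real_def abs_minus_commute)
    qed
    ultimately show "\<exists>T. openin nstar T \<and> U \<in> T \<and> T \<subseteq> {U \<in> nstar_points. nstar_extension g U \<in> W}"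
      using openin_nstar_clopen by blast
  qed
  then show ?thesis
    by (simp add: continuous_map_def nstar_extension_def)
qed

lemma nstar_extension_indicator:
  "nstar_extension (indicat_real A) = indicat_real (nstar_clopen A)"
proof
  fix U
  consider "U \<in> nstar_clopen A" | "U \<in> nstar_clopen (- A)" | "U \<notin> nstar_points"
    by (auto simp: nstar_clopen_Compl)
  then show "nstar_extension (indicat_real A) U = indicat_real (nstar_clopen A) U"
  proof cases
    case 1
    then have "U \<in> nstar_points" "eventually (\<lambda>n. indicat_real A n = 1) U"
      by (auto simp: nstar_clopen_def elim: eventually_mono)
    then show ?thesis
      using 1 by (simp add: nstar_extension_eqI tendsto_eventually)
  next
    case 2
    then have "U \<in> nstar_points" "eventually (\<lambda>n. indicat_real A n = 0) U"
      by (auto simp: nstar_clopen_def elim: eventually_mono)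
    then show ?thesis
      using 2 by (simp add: nstar_extension_eqI tendsto_eventually nstar_clopen_Compl)
  next
    case 3
    then show ?thesis
      by (simp add: nstar_extension_def nstar_clopen_def)
  qed
qed

text \<open>The canonical map of the quotient into the continuous functions on the Stone space. A
  limit is bounded by the supremum of every representative, hence by the quotient norm.\<close>

lemma linf_mod_c0_to_nstar:
  obtains \<Phi> where "bounded_operator linf_mod_c0 (continuous_space nstar) \<Phi>"
    and "\<And>g. bounded (range g) \<Longrightarrow> \<Phi> (c0_coset g) = nstar_extension g"
proof -
  \<comment> \<open>The choice of the representative is harmless by
    \<open>nstar_extension_cong\<close>.\<close>
  define \<Phi> where "\<Phi> C = nstar_extension (SOME g. g \<in> C)" for C
  have \<Phi>: "\<Phi> (c0_coset g) = nstar_extension g" if "bounded (range g)" for g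
  proof -
    have "(SOME h. h \<in> c0_coset g) \<in> c0_coset g"
      by (rule someI[where P = "\<lambda>h. h \<in> c0_coset g", OF c0_coset_refl[OF that]])
    then show ?thesis
      unfolding \<Phi>_def using that by (intro nstar_extension_cong) (auto simp: c0_coset_def)
  qed
  have "bounded_operator linf_mod_c0 (continuous_space nstar) \<Phi>"
    unfolding bounded_operator_def
  proof (intro conjI ballI allI exI[of _ 1])
    fix C assume "C \<in> carrier linf_mod_c0"
    then obtain g where g: "C = c0_coset g" "bounded (range g)"
      by (auto simp: carrier_linf_mod_c0)
    show "\<Phi> C \<in> carrier (continuous_space nstar)"
      using g \<Phi> nstar_extension_continuous by simp
    show "\<Phi> (c \<odot>\<^bsub>linf_mod_c0\<^esub> C) = c \<odot>\<^bsub>continuous_space nstar\<^esub> \<Phi> C" for c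
    proof -
      have "nstar_extension (\<lambda>n. c * g n) U = c * nstar_extension g U" for U
      proof (cases "U \<in> nstar_points")
        case True
        then show ?thesis
          by (intro nstar_extension_eqI tendsto_mult_left nstar_extension_tendsto g)
      qed (simp add: nstar_extension_def)
      then show ?thesis
        using g \<Phi> by (auto simp: smult_linf_mod_c0 bounded_scale)
    qed
    show "\<Phi> (C \<oplus>\<^bsub>linf_mod_c0\<^esub> C') = \<Phi> C \<oplus>\<^bsub>continuous_space nstar\<^esub> \<Phi> C'"
      if "C' \<in> carrier linf_mod_c0" for C'
    proof -
      obtain h where h: "C' = c0_coset h" "bounded (range h)"
        using \<open>C' \<in> carrier linf_mod_c0\<close> by (auto simp: carrier_linf_mod_c0)
      have "nstar_extension (\<lambda>n. g n + h n) U = nstar_extension g U + nstar_extension h U" for U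
      proof (cases "U \<in> nstar_points")
        case True
        then show ?thesis
          by (intro nstar_extension_eqI tendsto_add nstar_extension_tendsto g h)
      qed (simp add: nstar_extension_def)
      then show ?thesis
        using g h \<Phi> by (auto simp: add_linf_mod_c0 bounded_plus_comp)
    qed
    have "\<bar>nstar_extension g U\<bar> \<le> (SUP n. \<bar>h n\<bar>)" if "h \<in> c0_coset g" for h U
    proof (cases "U \<in> nstar_points")
      case True
      have h: "bounded (range h)" "nstar_extension h = nstar_extension g"
        using that g(2) by (auto simp: c0_coset_def intro: nstar_extension_cong)
      then show ?thesis
        using nstar_extension_le[OF h(1) True, of 0 "SUP n. \<bar>h n\<bar>"] abs_le_SUP_abs[OF h(1)] by simp
    next
      case False
      then show ?thesis
        using that by (auto simp: nstar_extension_def c0_coset_def intro: SUP_abs_nonneg)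
    qed
    then show "nrm (continuous_space nstar) (\<Phi> C) \<le> 1 * nrm linf_mod_c0 C"
      using c0_coset_refl[OF g(2)]
      by (auto simp: \<Phi> g nrm_linf_mod_c0 intro!: SUP_abs_le cINF_greatest)
  qed
  with \<Phi> that show ?thesis by blast
qed

section \<open>Sums of \<open>c_0\<close> coefficients over an almost disjoint family\<close>

text \<open>
  The function \<open>g\<close> represents the sum of the series \<open>\<Sum>A. x A * [1\<^sub>A]\<close> in \<open>\<ell>\<^sub>\<infinity>/c\<^sub>0\<close>.
\<close>

definition represents :: "nat set set \<Rightarrow> (nat set \<Rightarrow> real) \<Rightarrow> (nat \<Rightarrow> real) \<Rightarrow> bool" where
  "represents F x g \<longleftrightarrow>
     (\<forall>e>0. \<forall>\<^sub>F J in finite_subsets_at_top F. \<forall>\<^sub>F n in sequentially.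
        \<bar>g n - (\<Sum>A\<in>J. x A * indicat_real A n)\<bar> < e)"

lemma representsD:
  assumes "represents F x g" "0 < e"
  shows "\<forall>\<^sub>F J in finite_subsets_at_top F. \<forall>\<^sub>F n in sequentially.
    \<bar>g n - (\<Sum>A\<in>J. x A * indicat_real A n)\<bar> < e"
  using assms by (simp add: represents_def)

lemma represents_add:
  assumes "represents F x g" "represents F y h"
  shows "represents F (\<lambda>A. x A + y A) (\<lambda>n. g n + h n)"
  unfolding represents_def
proof (intro allI impI)
  fix e :: real assume "0 < e"
  then have "0 < e / 2" by simp
  from assms[THEN representsD, OF this] show "\<forall>\<^sub>F J in finite_subsets_at_top F. \<forall>\<^sub>F n in sequentially.
    \<bar>g n + h n - (\<Sum>A\<in>J. (x A + y A) * indicat_real A n)\<bar> < e"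
  proof eventually_elim
    case (elim J)
    then show ?case
    proof eventually_elim
      case (elim n)
      then show ?case
        unfolding distrib_right sum.distrib by linarith
    qed
  qed
qed

lemma represents_scale:
  assumes "represents F x g"
  shows "represents F (\<lambda>A. c * x A) (\<lambda>n. c * g n)"
  unfolding represents_def
proof (intro allI impI)
  fix e :: real assume "0 < e"
  \<comment> \<open>The denominator \<open>|c| + 1\<close> covers \<open>c = 0\<close> as
    well.\<close>
  then have "\<forall>\<^sub>F J in finite_subsets_at_top F. \<forall>\<^sub>F n in sequentially.
      \<bar>g n - (\<Sum>A\<in>J. x A * indicat_real A n)\<bar> < e / (\<bar>c\<bar> + 1)"
    by (intro representsD assms) simp
  then show "\<forall>\<^sub>F J in finite_subsets_at_top F. \<forall>\<^sub>F n in sequentially.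
    \<bar>c * g n - (\<Sum>A\<in>J. c * x A * indicat_real A n)\<bar> < e"
  proof eventually_elim
    case (elim J)
    then show ?case
    proof eventually_elim
      case (elim n)
      have "\<bar>c * g n - (\<Sum>A\<in>J. c * x A * indicat_real A n)\<bar>
          = \<bar>c\<bar> * \<bar>g n - (\<Sum>A\<in>J. x A * indicat_real A n)\<bar>"
        by (simp only: mult.assoc sum_distrib_left[symmetric] right_diff_distrib[symmetric] abs_mult)
      also have "\<dots> \<le> (\<bar>c\<bar> + 1) * \<bar>g n - (\<Sum>A\<in>J. x A * indicat_real A n)\<bar>"
        by (intro mult_right_mono) auto
      also have "\<dots> < e"
        using elim by (simp add: pos_less_divide_eq mult.commute)
      finally show ?case .
    qed
  qed
qed

text \<open>Makes the sum well defined modulo \<open>c_0\<close>; both functions are close to the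
  same finite partial sum.\<close>

lemma represents_unique:
  assumes "represents F x g" "represents F x h"
  shows "(\<lambda>n. g n - h n) \<longlonglongrightarrow> 0"
proof (rule tendstoI)
  fix e :: real assume "0 < e"
  then have "0 < e / 2" by simp
  from assms[THEN representsD, OF this] have "\<forall>\<^sub>F J in finite_subsets_at_top F. \<forall>\<^sub>F n in sequentially. dist (g n - h n) 0 < e"
  proof eventually_elim
    case (elim J)
    then show ?case
    proof eventually_elim
      case (elim n)
      then show ?case
        unfolding dist_real_def by linarith
    qed
  qed
  \<comment> \<open>\<open>J\<close> no longer occurs and \<open>finite_subsets_at_top F\<close> is
    a proper filter, so the outer quantifier drops.\<close>
  then show "\<forall>\<^sub>F n in sequentially. dist (g n - h n) 0 < e"
    by simp
qed

lemma represents_indicator: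
  assumes "A \<in> F"
  shows "represents F (indicat_real {A}) (indicat_real A)"
  unfolding represents_def
proof (intro allI impI)
  fix e :: real assume "0 < e"
  have "\<forall>\<^sub>F J in finite_subsets_at_top F. finite J \<and> A \<in> J"
    unfolding eventually_finite_subsets_at_top using assms by (intro exI[of _ "{A}"]) auto
  then show "\<forall>\<^sub>F J in finite_subsets_at_top F. \<forall>\<^sub>F n in sequentially.
      \<bar>indicat_real A n - (\<Sum>B\<in>J. indicat_real {A} B * indicat_real B n)\<bar> < e"
  proof eventually_elim
    case (elim J)
    have "(\<Sum>B\<in>J. indicat_real {A} B * indicat_real B n) = (\<Sum>B\<in>J. if B = A then indicat_real A n else 0)" for n
      by (intro sum.cong) (auto simp: indicator_def)
    then have "(\<Sum>B\<in>J. indicat_real {A} B * indicat_real B n) = indicat_real A n" for n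
      using elim by simp
    then show ?case
      using \<open>0 < e\<close> by simp
  qed
qed

text \<open>
  The representative takes at \<open>n\<close> the value of largest modulus among the \<open>x A\<close> with \<open>n \<in> A\<close>.
\<close>

lemma represents_exists:
  assumes ad: "\<And>A B. A \<in> F \<Longrightarrow> B \<in> F \<Longrightarrow> A \<noteq> B \<Longrightarrow> finite (A \<inter> B)"
    and x: "x \<in> carrier (c0 F)"
  obtains g where "represents F x g" "\<And>n. \<bar>g n\<bar> \<le> (SUP A. \<bar>x A\<bar>)"
proof -
  have fin: "finite {A. e \<le> \<bar>x A\<bar>}" if "0 < e" for e
    using x that by simp
  have x_F: "A \<in> F" if "x A \<noteq> 0" for A
    using x that by auto
  \<comment> \<open>Only finitely many coefficients reach a given positive modulus, so a largest one
    exists unless all those with \<open>n \<in> B\<close> vanish.\<close>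
  have "\<exists>v. (\<exists>A. n \<in> A \<and> v = x A \<and> (\<forall>B. n \<in> B \<longrightarrow> \<bar>x B\<bar> \<le> \<bar>v\<bar>)) \<or> (v = 0 \<and> (\<forall>B. n \<in> B \<longrightarrow> x B = 0))"
    for n :: nat
  proof (cases "\<exists>B. n \<in> B \<and> x B \<noteq> 0")
    case True
    then obtain B where B: "n \<in> B" "x B \<noteq> 0" by blast
    let ?S = "{A. \<bar>x B\<bar> \<le> \<bar>x A\<bar>} \<inter> {A. n \<in> A}"
    have S: "finite ?S" "?S \<noteq> {}"
      using fin[of "\<bar>x B\<bar>"] B by auto
    let ?m = "Max ((\<lambda>A. \<bar>x A\<bar>) ` ?S)"
    have "?m \<in> (\<lambda>A. \<bar>x A\<bar>) ` ?S"
      using S by (intro Max_in) auto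
    then obtain A where A: "A \<in> ?S" "?m = \<bar>x A\<bar>" by (rule imageE)
    have max: "\<bar>x C\<bar> \<le> \<bar>x A\<bar>" if "C \<in> ?S" for C
      unfolding A(2)[symmetric] using S(1) that by (intro Max_ge) auto
    have "\<bar>x C\<bar> \<le> \<bar>x A\<bar>" if "n \<in> C" for C
      using A(1) max[of C] that by (cases "\<bar>x B\<bar> \<le> \<bar>x C\<bar>") auto
    then show ?thesis
      using A(1) by blast
  qed auto
  then obtain g where g: "\<And>n. (\<exists>A. n \<in> A \<and> g n = x A \<and> (\<forall>B. n \<in> B \<longrightarrow> \<bar>x B\<bar> \<le> \<bar>g n\<bar>)) \<or>
      (g n = 0 \<and> (\<forall>B. n \<in> B \<longrightarrow> x B = 0))"
    by metis
  have le: "\<bar>x B\<bar> \<le> \<bar>g n\<bar>" if "n \<in> B" for n B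
    using g[of n] that by auto
  have "represents F x g"
    unfolding represents_def
  proof (intro allI impI)
    fix e :: real assume "0 < e"
    \<comment> \<open>Once \<open>J\<close> contains \<open>I\<close>, every coefficient outside
      \<open>J\<close> is below \<open>e / 2\<close> in modulus.\<close>
    define I where "I = {A. e / 2 \<le> \<bar>x A\<bar>}"
    have I: "finite I" "I \<subseteq> F"
      using fin[of "e / 2"] x_F \<open>0 < e\<close> by (auto simp: I_def)
    have "\<forall>\<^sub>F n in sequentially. \<bar>g n - (\<Sum>A\<in>J. x A * indicat_real A n)\<bar> < e"
      if J: "finite J" "I \<subseteq> J" "J \<subseteq> F" for J
    proof -
      \<comment> \<open>Off this finite set at most one member of \<open>J\<close> contains
        \<open>n\<close>, so the partial sum has at most one nonzero term.\<close>
      have "finite (\<Union>A\<in>J. \<Union>B\<in>J - {A}. A \<inter> B)"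
        using J by (intro finite_UN_I ad finite_Diff) auto
      then have "\<forall>\<^sub>F n in sequentially. n \<notin> (\<Union>A\<in>J. \<Union>B\<in>J - {A}. A \<inter> B)"
        by (simp only: cofinite_eq_sequentially[symmetric] eventually_cofinite not_not Collect_mem_eq)
      then show ?thesis
      proof eventually_elim
        case (elim n)
        then have single: "A = B" if "A \<in> J" "B \<in> J" "n \<in> A" "n \<in> B" for A B
          using that by blast
        show ?case
        proof (cases "\<exists>B\<in>J. n \<in> B")
          case True
          then obtain B where B: "B \<in> J" "n \<in> B" by blast
          have "(\<Sum>A\<in>J. x A * indicat_real A n) = (\<Sum>A\<in>J. if A = B then x B else 0)"
            using B single by (intro sum.cong) (auto simp: indicator_def)
          then have sum: "(\<Sum>A\<in>J. x A * indicat_real A n) = x B"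
            using J(1) B(1) by simp
          show ?thesis
          \<comment> \<open>A large \<open>g n\<close> is the coefficient of a member of
            \<open>J\<close>, which must be \<open>B\<close>. If \<open>g n\<close> is small, so is
            \<open>x B\<close>, and their difference is below \<open>e\<close>.\<close>
          proof (cases "e / 2 \<le> \<bar>g n\<bar>")
            case True
            then obtain A where A: "n \<in> A" "g n = x A"
              using g[of n] \<open>0 < e\<close> by auto
            then have "A \<in> J"
              using True J(2) by (auto simp: I_def)
            then have "A = B"
              using single A(1) B by blast
            then show ?thesis
              using A(2) sum \<open>0 < e\<close> by simp
          next
            case False
            then show ?thesis
              using le[OF B(2)] sum by linarith
          qed
        next
          case False
          then have sum: "(\<Sum>A\<in>J. x A * indicat_real A n) = 0"
            by (intro sum.neutral) auto
          have "\<bar>g n\<bar> < e / 2"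
          proof (rule ccontr)
            assume "\<not> \<bar>g n\<bar> < e / 2"
            moreover from this obtain A where "n \<in> A" "g n = x A"
              using g[of n] \<open>0 < e\<close> by auto
            ultimately have "A \<in> J" "n \<in> A"
              using J(2) by (auto simp: I_def)
            then show False using False by blast
          qed
          then show ?thesis
            using sum by simp
        qed
      qed
    qed
    then show "\<forall>\<^sub>F J in finite_subsets_at_top F. \<forall>\<^sub>F n in sequentially.
        \<bar>g n - (\<Sum>A\<in>J. x A * indicat_real A n)\<bar> < e"
      unfolding eventually_finite_subsets_at_top using I by blast
  qed
  moreover have "\<bar>g n\<bar> \<le> (SUP A. \<bar>x A\<bar>)" for n
    using g[of n] abs_le_SUP_abs[OF c0_bounded[OF x]] SUP_abs_nonneg[OF c0_bounded[OF x]] by auto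
  ultimately show ?thesis
    using that by blast
qed

text \<open>Representatives of \<open>x\<close> and \<open>y\<close> add to one of the sum, so
  uniqueness modulo \<open>c_0\<close> gives linearity; the pointwise bound from
  \<open>represents_exists\<close> gives norm at most \<open>1\<close>.\<close>

lemma c0_to_linf_mod_c0:
  assumes ad: "\<And>A B. A \<in> F \<Longrightarrow> B \<in> F \<Longrightarrow> A \<noteq> B \<Longrightarrow> finite (A \<inter> B)"
  obtains T where "bounded_operator (c0 F) linf_mod_c0 T"
    and "\<And>A. A \<in> F \<Longrightarrow> T (indicat_real {A}) = c0_coset (indicat_real A)"
proof -
  have "\<exists>g. represents F x g \<and> (\<forall>n. \<bar>g n\<bar> \<le> (SUP A. \<bar>x A\<bar>))" if "x \<in> carrier (c0 F)" for x
    using represents_exists[OF ad that] by metis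
  then obtain G where G: "\<And>x. x \<in> carrier (c0 F) \<Longrightarrow> represents F x (G x)"
    and G_le: "\<And>x n. x \<in> carrier (c0 F) \<Longrightarrow> \<bar>G x n\<bar> \<le> (SUP A. \<bar>x A\<bar>)"
    by metis
  have G_bounded: "bounded (range (G x))" if "x \<in> carrier (c0 F)" for x
    using G_le[OF that] by (auto simp: bounded_iff)
  define T where "T x = c0_coset (G x)" for x
  have T: "T x = c0_coset g" if "x \<in> carrier (c0 F)" "represents F x g" for x g
    unfolding T_def using represents_unique[OF G that(2)] that(1) by (intro c0_coset_eqI)
  interpret banach_space "c0 F" by (rule c0_banach)
  have add_closed: "(\<lambda>k. x k + y k) \<in> carrier (c0 F)" if "x \<in> carrier (c0 F)" "y \<in> carrier (c0 F)" for x y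
    using M.add.m_closed[OF that] by (simp only: add_c0)
  have scale_closed: "(\<lambda>k. c * x k) \<in> carrier (c0 F)" if "x \<in> carrier (c0 F)" for c x
    using smult_closed[OF _ that, of c] by (simp only: smult_c0) (simp add: real_ring_def)
  have "bounded_operator (c0 F) linf_mod_c0 T"
    unfolding bounded_operator_def
  proof (intro conjI ballI allI exI[of _ 1])
    fix x assume x: "x \<in> carrier (c0 F)"
    show "T x \<in> carrier linf_mod_c0"
      using G_bounded[OF x] by (auto simp: T_def carrier_linf_mod_c0)
    show "T (x \<oplus>\<^bsub>c0 F\<^esub> y) = T x \<oplus>\<^bsub>linf_mod_c0\<^esub> T y" if y: "y \<in> carrier (c0 F)" for y
    proof -
      have "T (\<lambda>k. x k + y k) = c0_coset (\<lambda>n. G x n + G y n)"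
        by (intro T add_closed represents_add G x y)
      then show ?thesis
        using G_bounded[OF x] G_bounded[OF y] by (simp add: T_def add_linf_mod_c0)
    qed
    show "T (c \<odot>\<^bsub>c0 F\<^esub> x) = c \<odot>\<^bsub>linf_mod_c0\<^esub> T x" for c
    proof -
      have "T (\<lambda>k. c * x k) = c0_coset (\<lambda>n. c * G x n)"
        by (intro T scale_closed represents_scale G x)
      then show ?thesis
        using G_bounded[OF x] by (simp add: T_def smult_linf_mod_c0)
    qed
    have "nrm linf_mod_c0 (T x) \<le> (SUP n. \<bar>G x n\<bar>)"
      unfolding T_def by (rule nrm_c0_coset_le[OF G_bounded[OF x]])
    also have "\<dots> \<le> (SUP A. \<bar>x A\<bar>)"
      by (rule SUP_abs_le) (rule G_le[OF x])
    finally show "nrm linf_mod_c0 (T x) \<le> 1 * nrm (c0 F) x"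
      by simp
  qed
  moreover have "T (indicat_real {A}) = c0_coset (indicat_real A)" if "A \<in> F" for A
  proof (rule T)
    have "{B. e \<le> \<bar>indicat_real {A} B\<bar>} \<subseteq> {A}" if "0 < e" for e
      using that by (auto simp: indicator_def)
    then show "indicat_real {A} \<in> carrier (c0 F)"
      using \<open>A \<in> F\<close> by (auto simp: indicator_def intro: finite_subset)
  qed (rule represents_indicator[OF that])
  ultimately show ?thesis
    using that by blast
qed

section \<open>Failure of universal injectivity, and the theorem\<close>

lemma mad_family_not_universally_injective:
  assumes F: "mad_family F"
  shows "\<not> universally_injective (c0 F) linf_mod_c0"
proof
  assume inj: "universally_injective (c0 F) linf_mod_c0"
  \<comment> \<open>The index set \<open>F\<close> is moved along the evaluations \<open>e\<close>, because universal injectivity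
    quantifies over spaces on the type \<open>('y \<Rightarrow> real) \<Rightarrow> real\<close> only.\<close>
  define e :: "nat set \<Rightarrow> (nat set \<Rightarrow> real) \<Rightarrow> real" where "e A = (\<lambda>y. y A)" for A
  have "inj e"
  proof (rule injI)
    fix A B assume "e A = e B"
    from fun_cong[OF this, of "indicat_real {A}"] show "A = B"
      by (simp add: e_def indicator_def split: if_splits)
  qed
  have ad: "\<And>A B. A \<in> F \<Longrightarrow> B \<in> F \<Longrightarrow> A \<noteq> B \<Longrightarrow> finite (A \<inter> B)"
    using F by (simp add: mad_family_def almost_disjoint_family_def)
  obtain T where T: "bounded_operator (c0 F) linf_mod_c0 T"
    "\<And>A. A \<in> F \<Longrightarrow> T (indicat_real {A}) = c0_coset (indicat_real A)"
    using c0_to_linf_mod_c0[OF ad] by metis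
  have c0_nonneg: "0 \<le> nrm (c0 F) x" if "x \<in> carrier (c0 F)" for x
    using c0_banach[of F] that
    by (simp add: banach_space_def real_normed_space.nrm_nonneg del: nrm_c0)
  have linf_c_nonneg: "0 \<le> nrm (linf_c (e ` F)) x" if "x \<in> carrier (linf_c (e ` F))" for x
    using linf_c_banach[of "e ` F"] that
    by (simp add: banach_space_def real_normed_space.nrm_nonneg del: nrm_linf_c)
  have "bounded_operator (c0 (e ` F)) linf_mod_c0 (T \<circ> (\<lambda>f. f \<circ> e))"
    using bounded_operator_comp_c0[OF \<open>inj e\<close>] T(1) c0_nonneg by (rule bounded_operator_comp)
  \<comment> \<open>The spaces \<open>c0\<close> and \<open>linf_c\<close> over the image of
    \<open>F\<close> under \<open>e\<close> play the roles of \<open>Z\<close> and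
    \<open>Z'\<close>.\<close>
  then obtain T' where T': "bounded_operator (linf_c (e ` F)) linf_mod_c0 T'"
    "\<And>z. z \<in> carrier (c0 (e ` F)) \<Longrightarrow> T' z = T (z \<circ> e)"
    using inj c0_banach linf_c_banach c0_reindex_isomorphic[OF \<open>inj e\<close>] c0_subspace_linf_c
    unfolding universally_injective_def by (metis comp_apply)
  obtain \<Phi> where \<Phi>: "bounded_operator linf_mod_c0 (continuous_space nstar) \<Phi>"
    "\<And>g. bounded (range g) \<Longrightarrow> \<Phi> (c0_coset g) = nstar_extension g"
    using linf_mod_c0_to_nstar by metis
  \<comment> \<open>\<open>reindex e\<close> brings the domain back to functions on
    \<open>F\<close>. It is undone by composition with \<open>e\<close>, so on unit vectors this
    operator agrees with \<open>\<Phi> \<circ> T\<close>.\<close>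
  let ?S = "(\<Phi> \<circ> T') \<circ> reindex e"
  have "bounded_operator (linf_c (e ` F)) (continuous_space nstar) (\<Phi> \<circ> T')"
    using T'(1) \<Phi>(1) nrm_linf_mod_c0_nonneg by (rule bounded_operator_comp)
  with bounded_operator_reindex_linf_c[OF \<open>inj e\<close>]
  have "bounded_operator (linf_c F) (continuous_space nstar) ?S"
    using linf_c_nonneg by (rule bounded_operator_comp)
  moreover have "?S (indicat_real {A}) = indicat_real (nstar_clopen A)" if "A \<in> F" for A
  proof -
    have "{B. c \<le> \<bar>indicat_real {A} B\<bar>} \<subseteq> {A}" if "0 < c" for c
      using that by (auto simp: indicator_def)
    then have "indicat_real {A} \<in> carrier (c0 F)"
      using \<open>A \<in> F\<close> by (auto simp: indicator_def intro: finite_subset)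
    then have "T' (reindex e (indicat_real {A})) = T (reindex e (indicat_real {A}) \<circ> e)"
      by (intro T' bounded_operatorD(1)[OF bounded_operator_reindex_c0[OF \<open>inj e\<close>]])
    also have "reindex e (indicat_real {A}) \<circ> e = indicat_real {A}"
      using \<open>inj e\<close> by (simp add: fun_eq_iff)
    finally have "?S (indicat_real {A}) = \<Phi> (c0_coset (indicat_real A))"
      using T(2)[OF that] by simp
    also have "\<dots> = nstar_extension (indicat_real A)"
      by (rule \<Phi>(2)) (auto simp: bounded_iff indicator_def)
    finally show ?thesis
      by (simp only: nstar_extension_indicator)
  qed
  ultimately show False
    by (rule mad_family_no_operator[OF F])
qed

theorem theorem1p6:
  shows "(\<exists>A :: nat set \<Rightarrow> nat set.
            inj_on A (Field \<aa>) \<and> almost_disjoint_family (A ` Field \<aa>) \<and>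
            \<not> (\<exists>S. bounded_operator (linf_c (Field \<aa>)) (continuous_space nstar) S \<and>
                   (\<forall>\<xi>\<in>Field \<aa>. S (indicat_real {\<xi>}) = indicat_real (nstar_clopen (A \<xi>)))))
         \<and> \<not> universally_injective (c0 (Field \<aa>)) linf_mod_c0"
proof -
  obtain F where F: "mad_family F" "\<aa> = |F|"
    using least_mad by (auto simp: least_mad_cardinal_def)
  \<comment> \<open>The cardinal of \<open>F\<close> is a well-order of \<open>F\<close> itself, so
    the family is indexed by its own members; hence the witness \<open>id\<close> below.\<close>
  have "Field \<aa> = F"
    unfolding F(2) by (rule Field_card_of)
  moreover have "almost_disjoint_family F"
    using F(1) by (simp add: mad_family_def)
  ultimately show ?thesis
    using mad_family_no_operator[OF F(1)] mad_family_not_universally_injective[OF F(1)]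
    by (intro conjI exI[of _ id]) auto
qed

end
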